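(* Let $\mathbf{A}=(A_1,A_2,A_3,A_4)$ be an irreducible tuple of monodromy group generators in $\mathrm{GL}_2(\mathbb{C})^4$ with $A_1,A_2,A_3$ (non-central) involutions. Taking the symmetric square $\mathrm{sym}^2$ and then applying the middle convolution $MC_{-1}$, one obtains a tuple of monodromy group generators $$\phi(\mathbf{A}):=MC_{-1}\circ\mathrm{sym}^2(\mathbf{A})=:\mathbf{B}=(B_1,B_2,B_3,B_4)$$ in $\mathrm{SL}_2(\mathbb{C})^4$ with $B_1,B_2,B_3$ unipotent. The induced transformation of the Fricke parameters $$\phi:\ \{(0,0,0,a_4,x,y,z)\}\to\{(2,2,2,b_4,x',y',z')\},$$ $$(0,0,0,a_4,x,y,z)\mapsto\big(2,2,2,\,-a_4^2-2,\,-(x^2-2),\,-(y^2-2),\,-(z^2-2)\big)$$ is bijective, when $\mathbf{A}$ is identified with $(\varepsilon_1A_1,\dots,\varepsilon_4A_4)$ for all $\varepsilon_i\in\{\pm1\}$ with $\prod_i\varepsilon_i=1$.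
   Context: A tuple of monodromy group generators is a tuple $(A_1,\dots,A_4)$ of invertible matrices with $A_1A_2A_3A_4=1$ whose eigenvalues are all roots of unity. Its Fricke parameters are $(a_1,a_2,a_3,a_4,x,y,z)$ with $a_i=\mathrm{tr}(A_i)$, $x=\mathrm{tr}(A_1A_2)$, $y=\mathrm{tr}(A_2A_3)$, $z=\mathrm{tr}(A_1A_3)$ (so $a_1=a_2=a_3=0$ for non-central involutions in $\mathrm{GL}_2$); $b_4,x',y',z'$ denote the corresponding quantities for $\mathbf{B}$. $\mathrm{sym}^2(\mathbf{A})$ is the tuple of $3\times3$ matrices given by the action on the symmetric square of $\mathbb{C}^2$. Middle convolution $MC_\lambda$ ($\lambda\in\mathbb{C}^*$): for $C_1,\dots,C_r\in\mathrm{GL}(V)$ (here $r=3$), let $D_k\in\mathrm{GL}(V^r)$ be the block matrix equal to the identity except that its $k$-th block row is $(\lambda(C_1-1),\dots,\lambda(C_{k-1}-1),\lambda C_k,C_{k+1}-1,\dots,C_r-1)$. The subspaces $K=\bigoplus_{k}\ker(C_k-1)$ (the $k$-th summand placed in the $k$-th component) and $L=\bigcap_k\ker(D_k-1)$ are invariant, and $MC_\lambda(C_1,\dots,C_r)$ is the tuple of maps induced by $D_1,\dots,D_r$ on $V^r/(K+L)$. For a 4-tuple with product $1$, one applies this to the first three entries and sets the fourth entry to be the inverse of the product of the resulting three.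
   Formalization: A_4 is assumed non-central (for Pauli matrices the convolution is zero); bijectivity is proved for all A, reducible or not, onto all unipotent B, and for irreducible A with A_4 non-central onto irreducible B minus the point (2,2,2,-2,-2,-2,-2), which only reducible A reach. *)

theory Defs
  imports "HOL-Analysis.Analysis"
begin

type_synonym 'n tuple4 =
  "(complex^'n^'n) \<times> (complex^'n^'n) \<times> (complex^'n^'n) \<times> (complex^'n^'n)"

definition root_of_unity :: "complex \<Rightarrow> bool" where
  "root_of_unity c \<longleftrightarrow> (\<exists>m>0. c ^ m = 1)"

definition eigenvalue :: "complex^'n^'n \<Rightarrow> complex \<Rightarrow> bool" where
  "eigenvalue M c \<longleftrightarrow> (\<exists>v. v \<noteq> 0 \<and> M *v v = c *s v)"

definition unipotent :: "complex^'n^'n \<Rightarrow> bool" where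
  "unipotent M \<longleftrightarrow> (\<exists>m. (((**) (M - mat 1)) ^^ m) (mat 1) = 0)"

definition central_GL :: "complex^'n^'n \<Rightarrow> bool" where
  "central_GL M \<longleftrightarrow> (\<forall>X. invertible X \<longrightarrow> M ** X = X ** M)"

definition noncentral_involution :: "complex^'n^'n \<Rightarrow> bool" where
  "noncentral_involution M \<longleftrightarrow> M ** M = mat 1 \<and> \<not> central_GL M"

fun monodromy_generators :: "'n::finite tuple4 \<Rightarrow> bool" where
  "monodromy_generators (A1, A2, A3, A4) \<longleftrightarrow>
     A1 ** A2 ** A3 ** A4 = mat 1 \<and>
     (\<forall>M\<in>{A1, A2, A3, A4}. invertible M \<and> (\<forall>c. eigenvalue M c \<longrightarrow> root_of_unity c))"

fun irreducible_tuple :: "'n::finite tuple4 \<Rightarrow> bool" where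
  "irreducible_tuple (A1, A2, A3, A4) \<longleftrightarrow>
     (\<forall>W. vec.subspace W \<and> (\<forall>M\<in>{A1, A2, A3, A4}. \<forall>v\<in>W. M *v v \<in> W) \<longrightarrow> W = {0} \<or> W = UNIV)"

subsection \<open>Symmetric square\<close>

text \<open>Coordinates on the symmetric square of the plane are taken with respect to the basis
  \<open>e1 e1, e1 e2, e2 e2\<close>; \<open>sym_prod u w\<close> is the product of two vectors in these coordinates.\<close>

definition sym_prod :: "complex^2 \<Rightarrow> complex^2 \<Rightarrow> complex^3" where
  "sym_prod u w = vector [u$1 * w$1, u$1 * w$2 + u$2 * w$1, u$2 * w$2]"

definition sym2 :: "complex^2^2 \<Rightarrow> complex^3^3" where
  "sym2 M = vector
     [vector [M$1$1 * M$1$1,     M$1$1 * M$1$2,                 M$1$2 * M$1$2],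
      vector [2 * M$1$1 * M$2$1, M$1$1 * M$2$2 + M$1$2 * M$2$1, 2 * M$1$2 * M$2$2],
      vector [M$2$1 * M$2$1,     M$2$1 * M$2$2,                 M$2$2 * M$2$2]]"

lemma sym2_sym_prod: "sym2 M *v sym_prod u w = sym_prod (M *v u) (M *v w)"
  by (simp add: vec_eq_iff forall_3 sym2_def sym_prod_def matrix_vector_mult_def
      sum_3 sum_2 algebra_simps)

fun sym2_tuple :: "2 tuple4 \<Rightarrow> 3 tuple4" where
  "sym2_tuple (A1, A2, A3, A4) = (sym2 A1, sym2 A2, sym2 A3, sym2 A4)"

subsection \<open>Middle convolution\<close>

text \<open>With \<open>V\<close> the space \<open>complex^'n\<close> and \<open>r\<close> the size of the ordered index type \<open>'r\<close>, the
  space \<open>V^r\<close> is \<open>complex^('r \<times> 'n)\<close>; \<open>component k v\<close> is the \<open>k\<close>-th component in \<open>V\<close>.\<close>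

definition component :: "'r \<Rightarrow> complex^('r::finite \<times> 'n::finite) \<Rightarrow> complex^'n" where
  "component k v = (\<chi> p. v $ (k, p))"

definition conv_block ::
  "complex \<Rightarrow> ('r::{finite,linorder} \<Rightarrow> complex^'n^'n) \<Rightarrow> 'r \<Rightarrow> complex^('r \<times> 'n)^('r \<times> 'n)" where
  "conv_block lam C k = (\<chi> i j.
     if fst i = k then
       (if fst j < k then lam * (C (fst j) - mat 1) $ snd i $ snd j
        else if fst j = k then lam * C k $ snd i $ snd j
        else (C (fst j) - mat 1) $ snd i $ snd j)
     else (mat 1 :: complex^('r \<times> 'n)^('r \<times> 'n)) $ i $ j)"

definition conv_K :: "('r::finite \<Rightarrow> complex^'n^'n) \<Rightarrow> (complex^('r \<times> 'n)) set" where
  "conv_K C = {v. \<forall>k. (C k - mat 1) *v component k v = 0}"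

definition conv_L ::
  "complex \<Rightarrow> ('r::{finite,linorder} \<Rightarrow> complex^'n^'n) \<Rightarrow> (complex^('r \<times> 'n)) set" where
  "conv_L lam C = {v. \<forall>k. (conv_block lam C k - mat 1) *v v = 0}"

text \<open>The middle convolution is a tuple of maps on a quotient space, hence a matrix tuple up to
  simultaneous conjugation. \<open>is_MC lam C B\<close> says that \<open>B\<close> is the matrix tuple of the maps induced
  on \<open>V^r / (K + L)\<close> in some basis: \<open>P\<close> is the coordinate form of the projection of \<open>V^r\<close> onto
  that quotient. In particular the size of \<open>B\<close> is the dimension of the quotient, and no \<open>B\<close> exists
  if the quotient has another dimension than \<open>'m\<close>.\<close>

definition is_MC ::
  "complex \<Rightarrow> ('r::{finite,linorder} \<Rightarrow> complex^'n^'n) \<Rightarrow> ('r \<Rightarrow> complex^'m^'m) \<Rightarrow> bool" where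
  "is_MC lam C B \<longleftrightarrow>
     (\<exists>P :: complex^('r \<times> 'n)^'m.
        surj ((*v) P) \<and>
        {v. P *v v = 0} = {u + w | u w. u \<in> conv_K C \<and> w \<in> conv_L lam C} \<and>
        (\<forall>k. P ** conv_block lam C k = B k ** P))"

text \<open>The index type \<open>3\<close> is ordered \<open>0 < 1 < 2\<close> (and \<open>3 = 0\<close> in it), so the three entries are
  placed at the positions \<open>0, 1, 2\<close>.\<close>

definition triple :: "'a \<Rightarrow> 'a \<Rightarrow> 'a \<Rightarrow> 3 \<Rightarrow> 'a" where
  "triple X Y Z i = (if i = 0 then X else if i = 1 then Y else Z)"

lemma order_3: "(0::3) < 1" "(1::3) < 2" "(UNIV :: 3 set) = {0, 1, 2}"
  using UNIV_3 by (auto simp: less_bit1_def bit1.Rep_0 bit1.Rep_1 bit1.Rep_numeral)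

fun is_MC4 :: "complex \<Rightarrow> 'n::finite tuple4 \<Rightarrow> 'm::finite tuple4 \<Rightarrow> bool" where
  "is_MC4 lam (C1, C2, C3, C4) (B1, B2, B3, B4) \<longleftrightarrow>
     is_MC lam (triple C1 C2 C3) (triple B1 B2 B3) \<and> B4 = matrix_inv (B1 ** B2 ** B3)"

definition is_phi :: "2 tuple4 \<Rightarrow> 2 tuple4 \<Rightarrow> bool" where
  "is_phi A B \<longleftrightarrow> is_MC4 (-1) (sym2_tuple A) B"

subsection \<open>Fricke parameters\<close>

type_synonym params = "complex \<times> complex \<times> complex \<times> complex \<times> complex \<times> complex \<times> complex"

fun fricke :: "'n::finite tuple4 \<Rightarrow> params" where
  "fricke (A1, A2, A3, A4) =
     (trace A1, trace A2, trace A3, trace A4, trace (A1 ** A2), trace (A2 ** A3), trace (A1 ** A3))"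

fun phi_params :: "params \<Rightarrow> params" where
  "phi_params (a1, a2, a3, a4, x, y, z) =
     (2, 2, 2, - (a4^2) - 2, - (x^2 - 2), - (y^2 - 2), - (z^2 - 2))"

definition involution_tuples :: "2 tuple4 set" where
  "involution_tuples = {(A1, A2, A3, A4). monodromy_generators (A1, A2, A3, A4) \<and>
     noncentral_involution A1 \<and> noncentral_involution A2 \<and> noncentral_involution A3}"

text \<open>The tuples to which \<open>phi\<close> applies. The only irreducible tuples of involutions with central
  \<open>A4\<close> are, up to conjugation and signs, the three Pauli matrices with \<open>A4 = \<plusminus> \<i>\<close>. For these
  \<open>K + L\<close> is all of \<open>V^3\<close>, so that their middle convolution lives on the zero space.\<close>

definition irreducible_involution_tuples :: "2 tuple4 set" where
  "irreducible_involution_tuples = {(A1, A2, A3, A4). (A1, A2, A3, A4) \<in> involution_tuples \<and>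
     irreducible_tuple (A1, A2, A3, A4) \<and> \<not> central_GL A4}"

definition unipotent_tuples :: "2 tuple4 set" where
  "unipotent_tuples = {(B1, B2, B3, B4). monodromy_generators (B1, B2, B3, B4) \<and>
     det B1 = 1 \<and> det B2 = 1 \<and> det B3 = 1 \<and> det B4 = 1 \<and>
     unipotent B1 \<and> unipotent B2 \<and> unipotent B3}"

text \<open>The parameters \<open>(2, 2, 2, -2, -2, -2, -2)\<close> belong to an irreducible unipotent tuple (the
  standard generators of the level two congruence subgroup), but the parameters
  \<open>(0, 0, 0, 0, x, y, z)\<close> with \<open>x\<^sup>2 = y\<^sup>2 = z\<^sup>2 = 4\<close> mapped to them come from reducible tuples of
  involutions only.\<close>

subsection \<open>Identification up to signs\<close>

fun sign_twist :: "complex \<times> complex \<times> complex \<times> complex \<Rightarrow> 'n::finite tuple4 \<Rightarrow> 'n tuple4" where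
  "sign_twist (s1, s2, s3, s4) (A1, A2, A3, A4) =
     (mat s1 ** A1, mat s2 ** A2, mat s3 ** A3, mat s4 ** A4)"

definition signs :: "(complex \<times> complex \<times> complex \<times> complex) set" where
  "signs = {(s1, s2, s3, s4). {s1, s2, s3, s4} \<subseteq> {1, -1} \<and> s1 * s2 * s3 * s4 = 1}"

text \<open>The relation on the Fricke parameters of the tuples in \<open>S\<close> induced by identifying every
  tuple with its sign twists.\<close>

definition sign_rel :: "2 tuple4 set \<Rightarrow> (params \<times> params) set" where
  "sign_rel S = {(fricke A, fricke (sign_twist s A)) | A s. A \<in> S \<and> s \<in> signs}"

text \<open>\<open>f\<close> is compatible with the identification and the map induced on classes is a bijection
  onto \<open>Y\<close>.\<close>

definition bij_on_classes :: "(params \<Rightarrow> params) \<Rightarrow> 2 tuple4 set \<Rightarrow> params set \<Rightarrow> bool" where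
  "bij_on_classes f S Y \<longleftrightarrow>
     equiv (fricke ` S) (sign_rel S) \<and> f respects (sign_rel S) \<and>
     bij_betw (\<lambda>c. the_elem (f ` c)) ((fricke ` S) // sign_rel S) Y"

end

theory Submission
  imports Defs
begin

text \<open>
  A noncentral involution in the plane is a traceless matrix of determinant \<open>-1\<close>. Its symmetric
  square has eigenvalues \<open>1, -1, 1\<close>, hence is a pseudoreflection \<open>1 + p q\<^sup>T\<close> of three-space, and the
  pairings between the covector of one involution and the vector of another are
  \<open>q\<^sub>i \<cdot> p\<^sub>j = - tr (A\<^sub>i A\<^sub>j)\<close> (\<open>sym2_involution\<close>, \<open>sym2_coroot_root\<close>).

  For pseudoreflections the quotient \<open>V^r / K\<close> has the coordinates \<open>w\<^sub>k = q\<^sub>k \<cdot> v\<^sub>k\<close>, and there the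
  \<open>k\<close>-th convolution matrix adds a multiple of the \<open>k\<close>-th unit vector, the multiple being a linear form
  in \<open>w\<close> with coefficients built from the pairings. The image of \<open>L\<close> is the common kernel of these
  linear forms (\<open>is_MC_pseudoreflections_iff\<close>). In the present case \<open>r = 3\<close>, \<open>\<lambda> = -1\<close> the diagonal
  coefficients cancel and the matrix of the three forms is antisymmetric with off-diagonal entries
  \<open>x, y, z\<close> up to sign. So as soon as \<open>(x, y, z) \<noteq> 0\<close> it has rank two and the quotient is a plane. Up to
  sign, this matrix consists of the areas spanned by the images \<open>u\<^sub>1, u\<^sub>2, u\<^sub>3\<close> of the unit vectors, once
  these are suitably scaled. Each \<open>B\<^sub>k\<close> is then the transvection along \<open>u\<^sub>k\<close> (\<open>is_phi_iff\<close>), and the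
  traces of products of transvections are polynomials in the areas, which gives the formula for the
  Fricke parameters.

  For the bijection everything is reduced to parameters. In the three-dimensional space of traceless
  matrices with the trace form, the square of \<open>tr (X Y Z)\<close> is a Gram determinant up to a constant
  (\<open>trace_triple_product_square\<close>). For involutions this reads \<open>a\<^sup>2 = x\<^sup>2 + y\<^sup>2 + z\<^sup>2 - x y z - 4\<close>; for
  unipotent matrices it says that the fourth trace is \<open>2 - x\<^sup>2 - y\<^sup>2 - z\<^sup>2 + x y z\<close> when \<open>2 - x\<^sup>2\<close>,
  \<open>2 - y\<^sup>2\<close>, \<open>2 - z\<^sup>2\<close> are the traces of the pairwise products and the sign of \<open>x\<close> is chosen
  suitably. Explicit matrices show that every solution occurs, and \<open>c \<mapsto> - c\<^sup>2\<close> carries the eigenvalues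
  of \<open>A\<^sub>4\<close> to those of \<open>B\<^sub>4\<close> or their inverses, so that the conditions on roots of unity correspond to
  each other. Since the relation determines \<open>x y z\<close> from the squares of all parameters, two points with
  the same image differ by signs whose product on \<open>x, y, z\<close> can be taken to be \<open>1\<close>, and these are exactly
  the signs that come from sign twists.

  Irreducibility can also be read off from the parameters. A unipotent tuple is reducible precisely
  when all areas vanish, that is \<open>x = y = z = 0\<close>. A tuple of involutions is irreducible with noncentral
  \<open>A\<^sub>4\<close> precisely when neither \<open>x = y = z = 0\<close> (then the involutions anticommute and \<open>A\<^sub>4\<close> is central)
  nor \<open>x\<^sup>2 = y\<^sup>2 = z\<^sup>2 = 4\<close>. In the last case the condition on roots of unity forces \<open>a = 0\<close>, and the
  image is the single point removed from the target.
\<close>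

section \<open>Linear algebra of the plane\<close>

lemmas mat2_simps = vec_eq_iff forall_2 matrix_matrix_mult_def matrix_vector_mult_def sum_2
  trace_def det_2 mat_def

definition area :: "complex^2 \<Rightarrow> complex^2 \<Rightarrow> complex" where
  "area u v = u$1 * v$2 - u$2 * v$1"

lemma area_eq_0_iff:
  assumes "v \<noteq> 0"
  shows "area v w = 0 \<longleftrightarrow> (\<exists>c. w = c *s v)"
proof
  assume w: "area v w = 0"
  from assms consider "v$1 \<noteq> 0" | "v$2 \<noteq> 0"
    by (auto simp: vec_eq_iff forall_2)
  then show "\<exists>c. w = c *s v"
  proof cases
    case 1
    then have "w = (w$1 / v$1) *s v"
      using w by (simp add: vec_eq_iff forall_2 area_def field_simps)
    then show ?thesis by blast
  next
    case 2
    then have "w = (w$2 / v$2) *s v"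
      using w by (simp add: vec_eq_iff forall_2 area_def field_simps)
    then show ?thesis by blast
  qed
qed (auto simp: area_def)

text \<open>Cramer's rule.\<close>

lemma area_expansion: "area u v *s w = area w v *s u + area u w *s v"
  by (simp add: vec_eq_iff forall_2 area_def algebra_simps)

lemma eigenvalue_iff_char_poly:
  fixes M :: "complex^2^2"
  shows "eigenvalue M c \<longleftrightarrow> c^2 - trace M * c + det M = 0"
proof -
  have "eigenvalue M c \<longleftrightarrow> \<not> (\<forall>v. (M - mat c) *v v = 0 \<longrightarrow> v = 0)"
    unfolding eigenvalue_def by (auto simp: mat2_simps algebra_simps)
  also have "\<dots> \<longleftrightarrow> det (M - mat c) = 0"
    by (simp flip: matrix_left_invertible_ker invertible_left_inverse add: invertible_det_nz)
  also have "det (M - mat c) = c^2 - trace M * c + det M"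
    by (simp add: mat2_simps algebra_simps power2_eq_square)
  finally show ?thesis .
qed

lemma monic_quadratic_has_root:
  fixes t d :: complex
  obtains c where "c^2 - t * c + d = 0"
proof
  define c where "c = (t + csqrt (t^2 - 4 * d)) / 2"
  have "2 * c - t = csqrt (t^2 - 4 * d)"
    by (simp add: c_def field_simps)
  then have "(2 * c - t)^2 = t^2 - 4 * d"
    by simp
  then show "c^2 - t * c + d = 0"
    by algebra
qed

lemma cayley_hamilton_2:
  fixes M :: "complex^2^2"
  shows "M ** M = mat (trace M) ** M - mat (det M)"
  by (simp add: mat2_simps algebra_simps)

text \<open>
  A unipotent matrix has \<open>1\<close> as its only eigenvalue; conversely, with trace \<open>2\<close> and determinant \<open>1\<close>
  the Cayley-Hamilton theorem for \<open>M - 1\<close> says that its square vanishes.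
\<close>

lemma unipotent_iff:
  fixes M :: "complex^2^2"
  assumes "det M = 1"
  shows "unipotent M \<longleftrightarrow> trace M = 2"
proof
  assume "unipotent M"
  then obtain m where m: "(((**) (M - mat 1)) ^^ m) (mat 1) = 0"
    unfolding unipotent_def by blast
  obtain c where c: "c^2 - trace M * c + det M = 0"
    using monic_quadratic_has_root .
  then obtain v where v: "v \<noteq> 0" "M *v v = c *s v"
    using eigenvalue_iff_char_poly unfolding eigenvalue_def by blast
  have "(((**) (M - mat 1)) ^^ k) (mat 1) *v v = (c - 1)^k *s v" for k
  proof (induction k)
    case (Suc k)
    have "(M - mat 1) *v v = (c - 1) *s v"
      by (simp add: v matrix_vector_mult_diff_rdistrib vec.scale_left_diff_distrib)
    then have "(M - mat 1) *v ((c - 1)^k *s v) = (c - 1)^Suc k *s v"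
      by (simp only: vec.scale vector_smult_assoc power_Suc2)
    moreover have "(((**) (M - mat 1)) ^^ Suc k) (mat 1) *v v
        = (M - mat 1) *v ((((**) (M - mat 1)) ^^ k) (mat 1) *v v)"
      by (simp add: matrix_vector_mul_assoc)
    ultimately show ?case
      using Suc by simp
  qed simp
  from this[of m] v m have "c = 1"
    by auto
  with c assms show "trace M = 2"
    by simp
next
  assume t: "trace M = 2"
  have "trace (M - mat 1) = trace M - 2" "det (M - mat 1) = det M - trace M + 1"
    by (simp_all add: mat2_simps algebra_simps)
  then have "(M - mat 1) ** (M - mat 1) = mat 0 ** (M - mat 1) - mat 0"
    using cayley_hamilton_2[of "M - mat 1"] t assms by simp
  also have "\<dots> = 0"
    by (simp add: mat2_simps)
  finally have "(M - mat 1) ** ((M - mat 1) ** mat 1) = 0"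
    by simp
  then have "(((**) (M - mat 1)) ^^ 2) (mat 1) = 0"
    by (simp add: numeral_2_eq_2)
  then show "unipotent M"
    unfolding unipotent_def by blast
qed

text \<open>
  Commuting with the two elementary transvections already forces a matrix to be scalar.
\<close>

lemma central_GL_iff:
  fixes M :: "complex^2^2"
  shows "central_GL M \<longleftrightarrow> (\<exists>c. M = mat c)"
proof
  assume M: "central_GL M"
  define U L :: "complex^2^2" where "U = vector [vector [1, 1], vector [0, 1]]"
    and "L = vector [vector [1, 0], vector [1, 1]]"
  have "invertible U" "invertible L"
    by (simp_all add: invertible_det_nz det_2 U_def L_def)
  with M have "M ** U = U ** M" "M ** L = L ** M"
    unfolding central_GL_def by blast+
  then have "M = mat (M$1$1)"
    by (simp add: mat2_simps U_def L_def)
  then show "\<exists>c. M = mat c" ..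
next
  assume "\<exists>c. M = mat c"
  then show "central_GL M"
    by (auto simp: central_GL_def mat2_simps)
qed

lemma noncentral_involution_iff:
  fixes M :: "complex^2^2"
  shows "noncentral_involution M \<longleftrightarrow> trace M = 0 \<and> det M = -1"
proof
  assume M: "noncentral_involution M"
  then have sq: "M ** M = mat 1" and nc: "\<And>c. M \<noteq> mat c"
    unfolding noncentral_involution_def central_GL_iff by auto
  have e: "M$1$1 * M$1$1 + M$1$2 * M$2$1 = 1" "M$1$2 * (M$1$1 + M$2$2) = 0"
    "M$2$1 * (M$1$1 + M$2$2) = 0" "M$2$1 * M$1$2 + M$2$2 * M$2$2 = 1"
    using sq by (simp_all add: mat2_simps algebra_simps)
  have tr: "M$1$1 + M$2$2 = 0"
  proof (rule ccontr)
    assume n: "M$1$1 + M$2$2 \<noteq> 0"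
    then have z: "M$1$2 = 0" "M$2$1 = 0"
      using e by auto
    then have "(M$1$1 - M$2$2) * (M$1$1 + M$2$2) = 0"
      using e by (simp add: algebra_simps)
    with n z have "M = mat (M$1$1)"
      by (simp add: mat2_simps)
    then show False
      using nc by blast
  qed
  then have "M$2$2 = - M$1$1"
    by (simp add: eq_neg_iff_add_eq_0 add.commute)
  moreover from this have "det M = - (M$1$1 * M$1$1 + M$1$2 * M$2$1)"
    by (simp add: det_2)
  ultimately show "trace M = 0 \<and> det M = -1"
    using e(1) by (simp add: trace_def sum_2)
next
  assume M: "trace M = 0 \<and> det M = -1"
  have "M ** M = mat 0 ** M - mat (-1)"
    using cayley_hamilton_2[of M] M by simp
  also have "\<dots> = mat 1"
    by (simp add: mat2_simps)
  finally have "M ** M = mat 1" .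
  moreover have "M \<noteq> mat c" for c
    using M by (auto simp: mat2_simps)
  ultimately show "noncentral_involution M"
    by (auto simp: noncentral_involution_def central_GL_iff)
qed

text \<open>
  In the plane a proper nonzero invariant subspace is a line. The fourth matrix is the inverse of the
  product of the others, so it preserves every line that they preserve. That \<open>v\<close> is an eigenvector is
  expressed by the polynomial condition \<open>area v (M v) = 0\<close>.
\<close>

lemma irreducible_iff_no_common_eigenvector:
  fixes A1 A2 A3 A4 :: "complex^2^2"
  assumes "A1 ** A2 ** A3 ** A4 = mat 1"
  shows "irreducible_tuple (A1, A2, A3, A4) \<longleftrightarrow>
    \<not> (\<exists>v. v \<noteq> 0 \<and> (\<forall>M\<in>{A1, A2, A3}. area v (M *v v) = 0))"
    (is "_ \<longleftrightarrow> \<not> ?ev")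
proof
  assume irr: "irreducible_tuple (A1, A2, A3, A4)"
  show "\<not> ?ev"
  proof
    assume ?ev
    then obtain v c1 c2 c3 where v: "v \<noteq> 0"
      and c: "A1 *v v = c1 *s v" "A2 *v v = c2 *s v" "A3 *v v = c3 *s v"
      by (auto simp: area_eq_0_iff)
    have "A4 ** (A1 ** A2 ** A3) = mat 1"
      using assms matrix_left_right_inverse by blast
    then have "v = A4 *v (A1 *v (A2 *v (A3 *v v)))"
      by (simp add: matrix_vector_mul_assoc matrix_mul_assoc)
    also have "\<dots> = (c1 * c2 * c3) *s (A4 *v v)"
      by (simp add: c vec.scale mult_ac)
    finally have e: "(c1 * c2 * c3) *s (A4 *v v) = v" ..
    with v have nz: "c1 * c2 * c3 \<noteq> 0"
      by (metis vec.scale_zero_left)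
    have "A4 *v v = inverse (c1 * c2 * c3) *s v"
      using arg_cong[OF e, of "(*s) (inverse (c1 * c2 * c3))"]
      by (simp only: vector_smult_assoc left_inverse[OF nz] vector_smult_lid)
    with c have inv: "\<forall>M\<in>{A1, A2, A3, A4}. \<exists>d. M *v v = d *s v"
      by blast
    define W where "W = {w. area v w = 0}"
    have W: "w \<in> W \<longleftrightarrow> (\<exists>d. w = d *s v)" for w
      by (simp add: W_def area_eq_0_iff v)
    have "vec.subspace W"
      unfolding vec.subspace_def by (auto simp: W_def area_def algebra_simps)
    moreover have "\<forall>M\<in>{A1, A2, A3, A4}. \<forall>w\<in>W. M *v w \<in> W"
    proof (intro ballI)
      fix M w assume "M \<in> {A1, A2, A3, A4}" "w \<in> W"
      then obtain d e where "M *v v = d *s v" "w = e *s v"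
        using inv W by blast
      then have "M *v w = (e * d) *s v"
        by (simp add: vec.scale)
      then show "M *v w \<in> W"
        unfolding W by blast
    qed
    ultimately have "W = {0} \<or> W = UNIV"
      using irr by simp
    moreover have "v \<in> W"
      by (simp add: W_def area_def)
    moreover have "vector [1, 0] \<notin> W \<or> vector [0, 1] \<notin> W"
      using v by (auto simp: W_def area_def vec_eq_iff forall_2)
    ultimately show False
      using v by auto
  qed
next
  assume ev: "\<not> ?ev"
  have "W = {0} \<or> W = UNIV"
    if W: "vec.subspace W" "\<forall>M\<in>{A1, A2, A3, A4}. \<forall>v\<in>W. M *v v \<in> W" for W
  proof (rule disjCI)
    assume "W \<noteq> UNIV"
    show "W = {0}"
    proof (rule ccontr)
      assume "W \<noteq> {0}"
      then obtain v where v: "v \<in> W" "v \<noteq> 0"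
        using W(1) vec.subspace_0 by blast
      then obtain M where M: "M \<in> {A1, A2, A3}" "area v (M *v v) \<noteq> 0"
        using ev by blast
      define u where "u = M *v v"
      have u: "u \<in> W" "area v u \<noteq> 0"
        using M v W(2) by (auto simp: u_def)
      have "w \<in> W" for w
      proof -
        have "inverse (area v u) *s (area w u *s v + area v w *s u) \<in> W"
          using v(1) u(1) W(1) by (intro vec.subspace_scale vec.subspace_add)
        then show ?thesis
          using u(2) by (simp flip: area_expansion)
      qed
      with \<open>W \<noteq> UNIV\<close> show False by blast
    qed
  qed
  then show "irreducible_tuple (A1, A2, A3, A4)"
    by simp
qed

text \<open>
  The kernel of a nonzero nilpotent \<open>N\<close> is spanned by any nonzero column of \<open>N\<close>, and for such a column
  \<open>v\<close> the quantity \<open>area v (X v)\<close> is a multiple of \<open>trace (N X)\<close>. So all matrices that are orthogonal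
  to \<open>N\<close> for the trace form share the eigenline.
\<close>

lemma nilpotent_kernel_is_eigenline:
  fixes N :: "complex^2^2"
  assumes "trace N = 0" "det N = 0" "N \<noteq> 0"
  obtains v where "v \<noteq> 0" "\<And>X. trace (N ** X) = 0 \<Longrightarrow> area v (X *v v) = 0"
proof -
  have N22: "N$2$2 = - N$1$1"
    using assms(1) by (simp add: trace_def sum_2 eq_neg_iff_add_eq_0 add.commute)
  have d: "N$1$2 * N$2$1 = - (N$1$1 * N$1$1)"
    using assms(2) by (simp add: det_2 N22 eq_neg_iff_add_eq_0)
  have t: "trace (N ** X) = N$1$1 * (X$1$1 - X$2$2) + N$1$2 * X$2$1 + N$2$1 * X$1$2" for X
    by (simp add: mat2_simps N22 algebra_simps)
  have 1: "area (column 1 N) (X *v column 1 N) = - N$2$1 * trace (N ** X)" for X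
    unfolding t area_def using d by (simp add: mat2_simps column_def) algebra
  have 2: "area (column 2 N) (X *v column 2 N) = N$1$2 * trace (N ** X)" for X
    unfolding t area_def using d by (simp add: mat2_simps column_def N22) algebra
  have "column 1 N \<noteq> 0 \<or> column 2 N \<noteq> 0"
    using assms(3) by (auto simp: column_def vec_eq_iff forall_2)
  then show thesis
    using that 1 2 by (metis mult_zero_right)
qed

text \<open>
  On the three-dimensional space of traceless matrices, \<open>trace (X Y Z)\<close> is an alternating trilinear
  form, so its square is a constant times the Gram determinant of the trace form; the diagonal Gram
  entries are \<open>trace (X X) = - 2 det X\<close>.
\<close>

lemma trace_triple_product_square:
  fixes X Y Z :: "complex^2^2"
  assumes "trace X = 0" "trace Y = 0" "trace Z = 0"
  shows "(trace (X ** Y ** Z))^2 =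
    4 * det X * det Y * det Z - trace (X ** Y) * trace (Y ** Z) * trace (X ** Z)
    - det X * (trace (Y ** Z))^2 - det Y * (trace (X ** Z))^2 - det Z * (trace (X ** Y))^2"
proof -
  have traceless: "trace M = 0 \<Longrightarrow> \<exists>a b c. M$1$1 = a \<and> M$1$2 = b \<and> M$2$1 = c \<and> M$2$2 = - a"
    for M :: "complex^2^2"
    by (simp add: trace_def sum_2 eq_neg_iff_add_eq_0 add.commute)
  obtain a b c where X: "X$1$1 = a" "X$1$2 = b" "X$2$1 = c" "X$2$2 = - a"
    using traceless[OF assms(1)] by blast
  obtain p q r where Y: "Y$1$1 = p" "Y$1$2 = q" "Y$2$1 = r" "Y$2$2 = - p"
    using traceless[OF assms(2)] by blast
  obtain u v w where Z: "Z$1$1 = u" "Z$1$2 = v" "Z$2$1 = w" "Z$2$2 = - u"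
    using traceless[OF assms(3)] by blast
  have pairs: "trace (X ** Y) = 2 * a * p + b * r + c * q" "trace (Y ** Z) = 2 * p * u + q * w + r * v"
    "trace (X ** Z) = 2 * a * u + b * w + c * v"
    by (simp_all add: mat2_simps X Y Z)
  have dets: "det X = - (a * a + b * c)" "det Y = - (p * p + q * r)" "det Z = - (u * u + v * w)"
    by (simp_all add: det_2 X Y Z)
  have triple: "trace (X ** Y ** Z) = a * (q * w - r * v) + b * (r * u - p * w) + c * (p * v - q * u)"
    by (simp only: trace_def sum_2 matrix_matrix_mult_def vec_lambda_beta X Y Z) algebra
  show ?thesis
    unfolding pairs dets triple power2_eq_square by algebra
qed

section \<open>Middle convolution of pseudoreflections\<close>

lemma component_conv_block_other:
  assumes "l \<noteq> k"
  shows "component l (conv_block lam C k *v v) = component l v"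
proof -
  have "(conv_block lam C k *v v) $ (l, i) = (mat 1 *v v) $ (l, i)" for i
    using assms by (simp add: conv_block_def matrix_vector_mult_def)
  then show ?thesis
    by (simp add: component_def vec_eq_iff)
qed

lemma component_conv_block_same:
  fixes C :: "'r::{finite,linorder} \<Rightarrow> complex^'n^'n"
  shows "component k (conv_block lam C k *v v) = lam *s component k v +
    (\<Sum>j\<in>UNIV. (if j \<le> k then lam else 1) *s ((C j - mat 1) *v component j v))"
proof -
  have "(conv_block lam C k *v v) $ (k, i) = lam * v$(k, i) +
    (\<Sum>j\<in>UNIV. (if j \<le> k then lam else 1) * ((C j - mat 1) *v component j v) $ i)" for i
  proof -
    define c where "c j = (if j \<le> k then lam else 1)" for j
    have entry: "conv_block lam C k $ (k, i) $ x =
        c (fst x) * (C (fst x) - mat 1) $ i $ snd x + (if x = (k, i) then lam else 0)" for x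
      by (cases x) (auto simp: conv_block_def c_def mat_def algebra_simps)
    have "(conv_block lam C k *v v) $ (k, i) = (\<Sum>x\<in>UNIV. conv_block lam C k $ (k, i) $ x * v $ x)"
      by (simp add: matrix_vector_mult_def)
    also have "\<dots> = (\<Sum>x\<in>UNIV. c (fst x) * (C (fst x) - mat 1) $ i $ snd x * v $ x
        + (if x = (k, i) then lam * v $ x else 0))"
      by (intro sum.cong refl) (simp add: entry distrib_right)
    also have "\<dots> = (\<Sum>x\<in>UNIV. c (fst x) * (C (fst x) - mat 1) $ i $ snd x * v $ x) + lam * v $ (k, i)"
      by (simp add: sum.distrib)
    also have "(\<Sum>x\<in>UNIV. c (fst x) * (C (fst x) - mat 1) $ i $ snd x * v $ x) =
        (\<Sum>j\<in>UNIV. c j * ((C j - mat 1) *v component j v) $ i)"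
      by (simp add: matrix_vector_mult_def component_def sum_distrib_left mult.assoc
          sum.cartesian_product case_prod_unfold)
    finally show ?thesis
      by (simp add: c_def add.commute)
  qed
  then show ?thesis
    by (simp add: vec_eq_iff component_def)
qed

definition pseudoreflection :: "complex^'n \<Rightarrow> complex^'n \<Rightarrow> complex^'n^'n" where
  "pseudoreflection p q = mat 1 + (\<chi> i j. p$i * q$j)"

lemma pseudoreflection_apply:
  "(pseudoreflection p q - mat 1) *v u = scalar_product q u *s p"
  by (simp add: pseudoreflection_def vec_eq_iff matrix_vector_mult_def scalar_product_def
      sum_distrib_left mult_ac)

text \<open>
  In the coordinates \<open>w\<^sub>j = q\<^sub>j \<cdot> v\<^sub>j\<close> the \<open>k\<close>-th convolution matrix adds the value of this linear form
  to the \<open>k\<close>-th coordinate (lemma \<open>covector_matrix_conv_block\<close> below).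
\<close>

definition conv_form ::
  "complex \<Rightarrow> ('r::{finite,linorder} \<Rightarrow> complex^'n) \<Rightarrow> ('r \<Rightarrow> complex^'n) \<Rightarrow> 'r \<Rightarrow> (complex, 'r) vec \<Rightarrow> complex"
  where "conv_form lam p q k w =
    (\<Sum>j\<in>UNIV. (if j \<le> k then lam else 1) * scalar_product (q k) (p j) * w$j) + (lam - 1) * w$k"

lemma scalar_product_add_right: "scalar_product q (u + v) = scalar_product q u + scalar_product q v"
  for u v :: "complex^'n"
  by (simp add: scalar_product_def algebra_simps sum.distrib)

lemma scalar_product_scale_right: "scalar_product q (c *s u) = c * scalar_product q u"
  for u :: "complex^'n"
  by (simp add: scalar_product_def algebra_simps sum_distrib_left)

lemma scalar_product_sum_right: "scalar_product q (\<Sum>j\<in>J. f j) = (\<Sum>j\<in>J. scalar_product q (f j))"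
  for q :: "complex^'n"
  by (induction J rule: infinite_finite_induct)
    (simp_all add: scalar_product_add_right, simp_all add: scalar_product_def)

definition covector_matrix :: "('r::finite \<Rightarrow> complex^'n) \<Rightarrow> (complex^('r \<times> 'n), 'r) vec" where
  "covector_matrix q = (\<chi> k x. if fst x = k then q k $ snd x else 0)"

lemma covector_matrix_apply:
  "(covector_matrix q *v v) $ k = scalar_product (q k) (component k v)"
proof -
  have "(covector_matrix q *v v) $ k
      = (\<Sum>j\<in>UNIV. \<Sum>m\<in>UNIV. if j = k then q k $ m * v $ (j, m) else 0)"
    by (simp add: covector_matrix_def matrix_vector_mult_def sum.cartesian_product
        case_prod_unfold if_distrib[of "\<lambda>a. a * _"] cong: if_cong)
      (rule sum.cong, simp, metis prod.collapse)
  also have "\<dots> = (\<Sum>j\<in>UNIV. if j = k then \<Sum>m\<in>UNIV. q k $ m * v $ (j, m) else 0)"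
    by (intro sum.cong) auto
  finally show ?thesis
    by (simp add: scalar_product_def component_def)
qed

lemma covector_matrix_conv_block:
  fixes p q :: "'r::{finite,linorder} \<Rightarrow> complex^'n"
  defines "Q \<equiv> covector_matrix q"
  shows "Q *v (conv_block lam (\<lambda>k. pseudoreflection (p k) (q k)) k *v v) =
    Q *v v + conv_form lam p q k (Q *v v) *s axis k 1"
proof -
  have "(Q *v (conv_block lam (\<lambda>k. pseudoreflection (p k) (q k)) k *v v)) $ l =
      (Q *v v) $ l + (if l = k then conv_form lam p q k (Q *v v) else 0)" for l
    by (cases "l = k")
      (simp_all add: Q_def covector_matrix_apply component_conv_block_other component_conv_block_same
        pseudoreflection_apply scalar_product_add_right scalar_product_scale_right
        scalar_product_sum_right conv_form_def, simp add: algebra_simps)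
  then show ?thesis
    by (simp add: vec_eq_iff axis_def)
qed

text \<open>
  The coordinates \<open>w\<close> vanish exactly on \<open>K\<close>. A vector of \<open>L\<close> is fixed by all convolution matrices, so
  the forms vanish on its coordinates. Conversely, if they vanish on the coordinates \<open>w\<close> of \<open>v\<close>, the
  equations that define \<open>L\<close> can be solved for a vector with coordinates \<open>w\<close>, because \<open>lam - 1\<close> is
  invertible; that vector differs from \<open>v\<close> by an element of \<open>K\<close>.
\<close>

lemma conv_K_plus_conv_L:
  fixes p q :: "'r::{finite,linorder} \<Rightarrow> complex^'n"
  assumes "lam \<noteq> 1" and p: "\<And>k. p k \<noteq> 0"
  defines "C \<equiv> \<lambda>k. pseudoreflection (p k) (q k)"
  defines "Q \<equiv> covector_matrix q"
  shows "conv_K C = {v. Q *v v = 0}"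
    and "{u + w | u w. u \<in> conv_K C \<and> w \<in> conv_L lam C} =
      {v. \<forall>k. conv_form lam p q k (Q *v v) = 0}"
proof -
  show K: "conv_K C = {v. Q *v v = 0}"
    using p by (auto simp: conv_K_def C_def pseudoreflection_apply Q_def covector_matrix_apply vec_eq_iff)
  have block: "Q *v (conv_block lam C k *v v) = Q *v v + conv_form lam p q k (Q *v v) *s axis k 1" for k v
    unfolding Q_def C_def by (rule covector_matrix_conv_block)
  show "{u + w | u w. u \<in> conv_K C \<and> w \<in> conv_L lam C} =
      {v. \<forall>k. conv_form lam p q k (Q *v v) = 0}"
  proof (intro Set.equalityI subsetI)
    fix v assume "v \<in> {u + w | u w. u \<in> conv_K C \<and> w \<in> conv_L lam C}"
    then obtain u w where v: "v = u + w" "Q *v u = 0" "w \<in> conv_L lam C"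
      using K by blast
    have "conv_form lam p q k (Q *v w) = 0" for k
    proof -
      have "conv_block lam C k *v w = w"
        using v(3) by (simp add: conv_L_def matrix_vector_mult_diff_rdistrib)
      then have "conv_form lam p q k (Q *v w) *s axis k 1 = 0"
        using block[of k w] by simp
      then have "(conv_form lam p q k (Q *v w) *s axis k (1::complex)) $ k = 0"
        by (simp only: zero_index)
      then show ?thesis
        by (simp add: axis_def)
    qed
    then show "v \<in> {v. \<forall>k. conv_form lam p q k (Q *v v) = 0}"
      using v by (simp add: matrix_vector_right_distrib)
  next
    fix v assume "v \<in> {v. \<forall>k. conv_form lam p q k (Q *v v) = 0}"
    then have form: "conv_form lam p q k (Q *v v) = 0" for k
      by simp
    define w where "w = Q *v v"
    \<comment> \<open>for \<open>l\<close> with coordinates \<open>w\<close>, the \<open>k\<close>-th equation of \<open>L\<close> reads \<open>(lam - 1) l\<^sub>k + a\<^sub>k = 0\<close>\<close>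
    define a where "a k = (\<Sum>j\<in>UNIV. ((if j \<le> k then lam else 1) * w$j) *s p j)" for k
    define l where "l = (\<chi> x. (inverse (1 - lam) *s a (fst x)) $ snd x)"
    have l: "component k l = inverse (1 - lam) *s a k" for k
      by (simp add: component_def l_def vec_eq_iff)
    have Ql: "Q *v l = w"
    proof -
      have "(Q *v l) $ k = w $ k" for k
      proof -
        have "scalar_product (q k) (a k) = (1 - lam) * w $ k"
          using form[of k] unfolding conv_form_def w_def[symmetric]
          by (simp add: a_def scalar_product_sum_right scalar_product_scale_right algebra_simps
              eq_neg_iff_add_eq_0)
        then show ?thesis
          using assms(1) by (simp add: Q_def covector_matrix_apply l scalar_product_scale_right)
      qed
      then show ?thesis
        by (simp add: vec_eq_iff)
    qed
    have "conv_block lam C k *v l = l" for k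
    proof -
      have "component i (conv_block lam C k *v l) = component i l" for i
      proof (cases "i = k")
        case True
        have "component k (conv_block lam C k *v l) = lam *s component k l + a k"
          unfolding component_conv_block_same a_def
          by (simp add: C_def pseudoreflection_apply flip: Ql covector_matrix_apply Q_def)
        also have "\<dots> = (lam * inverse (1 - lam) + 1) *s a k"
          by (simp add: l vec.scale_left_distrib)
        also have "lam * inverse (1 - lam) + 1 = inverse (1 - lam)"
          using assms(1) by (simp add: field_simps)
        finally show ?thesis
          by (simp add: True l)
      qed (simp add: component_conv_block_other)
      then show ?thesis
        by (simp add: component_def vec_eq_iff)
    qed
    then have "l \<in> conv_L lam C"
      by (simp add: conv_L_def matrix_vector_mult_diff_rdistrib)
    moreover have "v - l \<in> conv_K C"
      by (simp add: K matrix_vector_mult_diff_distrib Ql w_def)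
    ultimately show "v \<in> {u + w | u w. u \<in> conv_K C \<and> w \<in> conv_L lam C}"
      by (smt (verit) mem_Collect_eq diff_add_cancel)
  qed
qed

lemma matrix_vector_mult_axis: "R *v axis k 1 = column k R" for R :: "(complex, 'r::finite) vec^'m"
  by (simp add: vec_eq_iff matrix_vector_mult_def axis_def column_def
      if_distrib[of "\<lambda>a. _ * a"] cong: if_cong)

text \<open>
  The projection of \<open>V^r\<close> onto \<open>V^r / (K + L)\<close> factors through the coordinates \<open>w\<close>, so the middle
  convolution can be computed on the quotient \<open>R\<close> of the small space of coordinates by the common
  kernel of the forms.
\<close>

lemma is_MC_pseudoreflections_iff:
  fixes p q :: "'r::{finite,linorder} \<Rightarrow> complex^'n" and B :: "'r \<Rightarrow> complex^'m^'m"
  assumes "lam \<noteq> 1" and qp: "\<And>k. scalar_product (q k) (p k) \<noteq> 0"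
  shows "is_MC lam (\<lambda>k. pseudoreflection (p k) (q k)) B \<longleftrightarrow>
    (\<exists>R :: (complex, 'r) vec^'m. surj ((*v) R) \<and>
      (\<forall>w. R *v w = 0 \<longleftrightarrow> (\<forall>k. conv_form lam p q k w = 0)) \<and>
      (\<forall>k w. B k *v (R *v w) = R *v w + conv_form lam p q k w *s column k R))"
    (is "_ \<longleftrightarrow> (\<exists>R. ?quot R)")
proof -
  define C where "C k = pseudoreflection (p k) (q k)" for k
  define Q where "Q = covector_matrix q"
  \<comment> \<open>a section of the coordinate map \<open>Q\<close>\<close>
  define S :: "(complex, 'r) vec^('r \<times> 'n)" where
    "S = (\<chi> x k. if fst x = k then p k $ snd x / scalar_product (q k) (p k) else 0)"
  have p: "p k \<noteq> 0" for k
    using qp[of k] by (auto simp: scalar_product_def)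
  note KL = conv_K_plus_conv_L[where q = q and p = p, OF assms(1) p, folded C_def Q_def]
  have block: "Q *v (conv_block lam C k *v v) = Q *v v + conv_form lam p q k (Q *v v) *s axis k 1" for k v
    unfolding Q_def C_def by (rule covector_matrix_conv_block)
  have col: "R *v (w + c *s axis k 1) = R *v w + c *s column k R" for R :: "(complex, 'r) vec^'m" and w c k
    by (simp add: matrix_vector_right_distrib vec.scale matrix_vector_mult_axis)
  have QS: "Q *v (S *v w) = w" for w
  proof -
    have "component k (S *v w) = (w$k / scalar_product (q k) (p k)) *s p k" for k
      by (simp add: S_def component_def matrix_vector_mult_def vec_eq_iff
          if_distrib[of "\<lambda>a. a * _"] cong: if_cong)
    then have "(Q *v (S *v w)) $ k = w $ k" for k
      using qp[of k] by (simp add: Q_def covector_matrix_apply scalar_product_scale_right)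
    then show ?thesis
      by (simp add: vec_eq_iff)
  qed
  have "is_MC lam C B \<longleftrightarrow> (\<exists>R. ?quot R)"
  proof
    assume "is_MC lam C B"
    then obtain P :: "complex^('r \<times> 'n)^'m" where P: "surj ((*v) P)"
      "{v. P *v v = 0} = {u + w | u w. u \<in> conv_K C \<and> w \<in> conv_L lam C}"
      "\<And>k. P ** conv_block lam C k = B k ** P"
      unfolding is_MC_def by blast
    have ker: "P *v v = 0 \<longleftrightarrow> (\<forall>k. conv_form lam p q k (Q *v v) = 0)" for v
      using P(2)[unfolded KL(2)] by (simp add: set_eq_iff)
    define R where "R = P ** S"
    have PR: "P *v v = R *v (Q *v v)" for v
    proof -
      have "P *v (v - S *v (Q *v v)) = 0"
        unfolding ker by (simp add: matrix_vector_mult_diff_distrib QS conv_form_def)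
      then show ?thesis
        by (simp add: R_def matrix_vector_mult_diff_distrib flip: matrix_vector_mul_assoc)
    qed
    have RP: "R *v w = P *v (S *v w)" for w
      by (simp add: R_def flip: matrix_vector_mul_assoc)
    have "?quot R"
    proof (intro conjI allI)
      show "surj ((*v) R)"
        using P(1) unfolding surj_def PR by metis
      show "R *v w = 0 \<longleftrightarrow> (\<forall>k. conv_form lam p q k w = 0)" for w
        by (simp add: RP ker QS)
      show "B k *v (R *v w) = R *v w + conv_form lam p q k w *s column k R" for k w
      proof -
        have "B k *v (P *v v) = P *v (conv_block lam C k *v v)" for v
          by (simp only: matrix_vector_mul_assoc P(3))
        then have "B k *v (R *v w) = P *v (conv_block lam C k *v (S *v w))"
          by (simp only: RP)
        also have "\<dots> = R *v w + conv_form lam p q k w *s column k R"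
          by (simp only: PR block QS col)
        finally show ?thesis .
      qed
    qed
    then show "\<exists>R. ?quot R" ..
  next
    assume "\<exists>R. ?quot R"
    then obtain R where R: "surj ((*v) R)"
      "\<And>w. R *v w = 0 \<longleftrightarrow> (\<forall>k. conv_form lam p q k w = 0)"
      "\<And>k w. B k *v (R *v w) = R *v w + conv_form lam p q k w *s column k R"
      by blast
    have PR: "(R ** Q) *v v = R *v (Q *v v)" for v
      by (simp flip: matrix_vector_mul_assoc)
    show "is_MC lam C B"
      unfolding is_MC_def
    proof (intro exI conjI allI)
      show "surj ((*v) (R ** Q))"
        using R(1) unfolding surj_def PR by (metis QS)
      show "{v. (R ** Q) *v v = 0} = {u + w | u w. u \<in> conv_K C \<and> w \<in> conv_L lam C}"
        unfolding KL(2) by (simp add: PR R(2))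
      fix k
      have "(R ** Q ** conv_block lam C k) *v v = (B k ** (R ** Q)) *v v" for v
      proof -
        have "(R ** Q ** conv_block lam C k) *v v = R *v (Q *v (conv_block lam C k *v v))"
          by (simp only: matrix_vector_mul_assoc matrix_mul_assoc)
        also have "\<dots> = B k *v (R *v (Q *v v))"
          by (simp only: block col R(3))
        finally show ?thesis
          by (simp only: matrix_vector_mul_assoc matrix_mul_assoc)
      qed
      then show "R ** Q ** conv_block lam C k = B k ** (R ** Q)"
        by (simp add: matrix_eq)
    qed
  qed
  then show ?thesis
    by (simp add: C_def[abs_def])
qed

section \<open>The symmetric square of an involution and its middle convolution\<close>

text \<open>
  The vector \<open>p\<close> and the covector \<open>q\<close> with \<open>sym2 A = 1 + p q\<^sup>T\<close> for an involution \<open>A\<close>. Up to a factor,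
  \<open>p\<close> is the product of the two eigenvectors of \<open>A\<close>.
\<close>

definition sym2_root :: "complex^2^2 \<Rightarrow> complex^3" where
  "sym2_root A = vector [A$1$2, - 2 * A$1$1, - A$2$1]"

definition sym2_coroot :: "complex^2^2 \<Rightarrow> complex^3" where
  "sym2_coroot A = vector [- A$2$1, A$1$1, A$1$2]"

lemma sym2_involution:
  assumes "trace A = 0" "det A = -1"
  shows "sym2 A = pseudoreflection (sym2_root A) (sym2_coroot A)"
proof -
  have A22: "A$2$2 = - A$1$1"
    using assms(1) by (simp add: trace_def sum_2 eq_neg_iff_add_eq_0 add.commute)
  have det: "A$1$1 * A$1$1 = 1 - A$1$2 * A$2$1"
    using assms(2) unfolding det_2 A22 by algebra
  show ?thesis
    by (simp add: pseudoreflection_def sym2_def sym2_root_def sym2_coroot_def vec_eq_iff forall_3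
        mat_def A22 det mult.commute) (use det in algebra)
qed

lemma sym2_coroot_root:
  assumes "trace A = 0" "trace A' = 0"
  shows "scalar_product (sym2_coroot A) (sym2_root A') = - trace (A ** A')"
proof -
  have "A$2$2 = - A$1$1" "A'$2$2 = - A'$1$1"
    using assms by (simp_all add: trace_def sum_2 eq_neg_iff_add_eq_0 add.commute)
  then show ?thesis
    by (simp add: scalar_product_def sym2_root_def sym2_coroot_def sum_3 mat2_simps)
qed

definition transvection :: "complex^2 \<Rightarrow> complex^2^2" where
  "transvection u = vector [vector [1 + u$1 * u$2, - (u$1 * u$1)], vector [u$2 * u$2, 1 - u$1 * u$2]]"

lemma transvection_apply: "transvection u *v w = w - area u w *s u"
  by (simp add: transvection_def vec_eq_iff forall_2 matrix_vector_mult_def sum_2 area_def algebra_simps)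

lemma sum_over_3: "(\<Sum>j\<in>UNIV. f j) = f 0 + f 1 + f 2" for f :: "3 \<Rightarrow> 'a::comm_monoid_add"
proof -
  have "(0::3) \<noteq> 1" "(1::3) \<noteq> 2" "(0::3) \<noteq> 2"
    using order_3(1,2) by (auto dest: less_trans)
  then show ?thesis
    unfolding order_3(3) by (simp add: add.assoc)
qed

lemma forall_over_3: "(\<forall>j. P j) \<longleftrightarrow> P 0 \<and> P 1 \<and> P 2" for P :: "3 \<Rightarrow> bool"
proof -
  have "(\<forall>j. P j) \<longleftrightarrow> (\<forall>j\<in>UNIV. P j)"
    by simp
  then show ?thesis
    unfolding order_3(3) by simp
qed

lemma surj_if_area_nonzero:
  fixes R :: "(complex, 'r::finite) vec^2"
  assumes "area (column i R) (column j R) \<noteq> 0"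
  shows "surj ((*v) R)"
proof -
  define D where "D = area (column i R) (column j R)"
  have "R *v (inverse D *s (area v (column j R) *s axis i 1 + area (column i R) v *s axis j 1))
      = inverse D *s (D *s v)" for v
    by (simp only: matrix_vector_right_distrib vec.scale matrix_vector_mult_axis D_def
        area_expansion[of "column i R" "column j R" v])
  then have "R *v (inverse D *s (area v (column j R) *s axis i 1 + area (column i R) v *s axis j 1)) = v" for v
    using assms by (simp add: D_def)
  then show ?thesis
    unfolding surj_def by metis
qed

lemma area_kernel_trivial:
  assumes "area u v \<noteq> 0" "area u w = 0" "area v w = 0"
  shows "w = 0"
proof -
  have "area w v = 0"
    using assms(3) unfolding area_def by algebra
  with assms(2) have "area w v *s u + area u w *s v = 0"
    by simp
  then have "area u v *s w = 0"
    by (rule trans[OF area_expansion])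
  with assms(1) show ?thesis
    by simp
qed

text \<open>
  The three linear forms are \<open>- (x w\<^sub>1 + z w\<^sub>2)\<close>, \<open>x w\<^sub>0 - y w\<^sub>2\<close> and \<open>z w\<^sub>0 + y w\<^sub>1\<close>, with common kernel
  spanned by \<open>(y, -z, x)\<close>. Let \<open>r\<^sub>1, r\<^sub>2, r\<^sub>3\<close> be the images of the unit vectors in the quotient plane.
  The relation \<open>y r\<^sub>1 - z r\<^sub>2 + x r\<^sub>3 = 0\<close> makes their areas proportional to \<open>x, y, z\<close>, with a nonzero
  factor \<open>d\<close> because the \<open>r\<^sub>k\<close> span the plane. Dividing them by a square root of \<open>d\<close> gives vectors with
  areas \<open>x, y, z\<close>, and the linear forms become the areas that appear in the transvections.
\<close>

lemma is_phi_iff: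
  assumes A: "trace A1 = 0" "det A1 = -1" "trace A2 = 0" "det A2 = -1" "trace A3 = 0" "det A3 = -1"
    and x: "x = trace (A1 ** A2)" and y: "y = trace (A2 ** A3)" and z: "z = trace (A1 ** A3)"
    and nz: "\<not> (x = 0 \<and> y = 0 \<and> z = 0)"
  shows "is_phi (A1, A2, A3, A4) (B1, B2, B3, B4) \<longleftrightarrow>
    (\<exists>u1 u2 u3. area u1 u2 = x \<and> area u2 u3 = y \<and> area u1 u3 = z \<and>
      B1 = transvection u1 \<and> B2 = transvection u2 \<and> B3 = transvection u3) \<and>
    B4 = matrix_inv (B1 ** B2 ** B3)"
proof -
  have less: "(0::3) < 1" "(1::3) < 2" "(0::3) < 2" and neq: "(0::3) \<noteq> 1" "(1::3) \<noteq> 2" "(0::3) \<noteq> 2"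
    using order_3 by (auto dest: less_trans)
  have le: "\<not> (1::3) \<le> 0" "\<not> (2::3) \<le> 1" "\<not> (2::3) \<le> 0"
    "(0::3) \<le> 1" "(1::3) \<le> 2" "(0::3) \<le> 2"
    using less by (simp_all add: not_le less_imp_le)
  define p where "p k = sym2_root (triple A1 A2 A3 k)" for k
  define q where "q k = sym2_coroot (triple A1 A2 A3 k)" for k
  have tr: "trace (triple A1 A2 A3 k) = 0" and dt: "det (triple A1 A2 A3 k) = -1" for k
    using A by (auto simp: triple_def)
  have sq: "trace (M ** M) = 2" if "trace M = 0" "det M = -1" for M :: "complex^2^2"
  proof -
    have "M ** M = mat 0 ** M - mat (-1)"
      using cayley_hamilton_2[of M] that by simp
    then show ?thesis
      by (simp add: mat2_simps)
  qed
  have sym: "triple (sym2 A1) (sym2 A2) (sym2 A3) = (\<lambda>k. pseudoreflection (p k) (q k))"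
    using A by (auto simp: p_def q_def triple_def fun_eq_iff sym2_involution)
  have qp: "scalar_product (q k) (p j) = - trace (triple A1 A2 A3 k ** triple A1 A2 A3 j)" for k j
    unfolding q_def p_def by (intro sym2_coroot_root tr)
  have comm: "trace (A2 ** A1) = x" "trace (A3 ** A2) = y" "trace (A3 ** A1) = z"
    unfolding x y z by (rule trace_mul_sym)+
  have form: "conv_form (-1) p q 0 w = - (x * w$1 + z * w$2)"
    "conv_form (-1) p q 1 w = x * w$0 - y * w$2"
    "conv_form (-1) p q 2 w = z * w$0 + y * w$1" for w
    unfolding conv_form_def sum_over_3 qp
    by (simp_all add: triple_def neq neq[symmetric] le comm sq A algebra_simps flip: x y z)
  have "is_phi (A1, A2, A3, A4) (B1, B2, B3, B4) \<longleftrightarrow>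
      is_MC (-1) (\<lambda>k. pseudoreflection (p k) (q k)) (triple B1 B2 B3) \<and> B4 = matrix_inv (B1 ** B2 ** B3)"
    by (simp add: is_phi_def sym)
  also have "is_MC (-1) (\<lambda>k. pseudoreflection (p k) (q k)) (triple B1 B2 B3) \<longleftrightarrow>
    (\<exists>R :: (complex, 3) vec^2. surj ((*v) R) \<and>
      (\<forall>w. R *v w = 0 \<longleftrightarrow> - (x * w$1 + z * w$2) = 0 \<and> x * w$0 - y * w$2 = 0 \<and> z * w$0 + y * w$1 = 0) \<and>
      (\<forall>w. B1 *v (R *v w) = R *v w + (- (x * w$1 + z * w$2)) *s column 0 R) \<and>
      (\<forall>w. B2 *v (R *v w) = R *v w + (x * w$0 - y * w$2) *s column 1 R) \<and>
      (\<forall>w. B3 *v (R *v w) = R *v w + (z * w$0 + y * w$1) *s column 2 R))"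
    (is "_ \<longleftrightarrow> (\<exists>R. ?quot R)")
  proof -
    have "(-1 :: complex) \<noteq> 1" "\<And>k. scalar_product (q k) (p k) \<noteq> 0"
      by (simp_all add: qp sq tr dt)
    moreover have "triple B1 B2 B3 0 = B1" "triple B1 B2 B3 1 = B2" "triple B1 B2 B3 2 = B3"
      by (simp_all add: triple_def neq neq[symmetric])
    ultimately show ?thesis
      by (simp only: is_MC_pseudoreflections_iff forall_over_3 form not_False_eq_True)
  qed
  finally have phi: "is_phi (A1, A2, A3, A4) (B1, B2, B3, B4) \<longleftrightarrow>
    (\<exists>R. ?quot R) \<and> B4 = matrix_inv (B1 ** B2 ** B3)" .
  have R_apply: "R *v w = w$0 *s column 0 R + w$1 *s column 1 R + w$2 *s column 2 R"
    for R :: "(complex, 3) vec^2" and w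
    by (simp add: matrix_mult_sum sum_over_3)
  have to_transvections: "\<exists>u1 u2 u3. area u1 u2 = x \<and> area u2 u3 = y \<and> area u1 u3 = z \<and>
      B1 = transvection u1 \<and> B2 = transvection u2 \<and> B3 = transvection u3" if "?quot R" for R
  proof -
    from that have surj: "surj ((*v) R)"
      and ker: "\<And>w. R *v w = 0 \<longleftrightarrow>
        - (x * w$1 + z * w$2) = 0 \<and> x * w$0 - y * w$2 = 0 \<and> z * w$0 + y * w$1 = 0"
      and B: "\<And>w. B1 *v (R *v w) = R *v w + (- (x * w$1 + z * w$2)) *s column 0 R"
        "\<And>w. B2 *v (R *v w) = R *v w + (x * w$0 - y * w$2) *s column 1 R"
        "\<And>w. B3 *v (R *v w) = R *v w + (z * w$0 + y * w$1) *s column 2 R"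
      by blast+
    define r1 r2 r3 where "r1 = column 0 R" and "r2 = column 1 R" and "r3 = column 2 R"
    have R: "R *v w = w$0 *s r1 + w$1 *s r2 + w$2 *s r3" for w
      by (simp add: R_apply r1_def r2_def r3_def)
    \<comment> \<open>the generator of the common kernel of the forms\<close>
    define w0 :: "complex^3" where "w0 = (\<chi> k. if k = 0 then y else if k = 1 then - z else x)"
    have w0: "w0$0 = y" "w0$1 = - z" "w0$2 = x"
      using neq by (auto simp: w0_def)
    have "R *v w0 = 0"
      unfolding ker w0 by (simp add: mult.commute)
    then have rel: "y *s r1 - z *s r2 + x *s r3 = 0"
      by (simp add: R w0)
    have "area r1 (y *s r1 - z *s r2 + x *s r3) = 0" "area r2 (y *s r1 - z *s r2 + x *s r3) = 0"
      "area r3 (y *s r1 - z *s r2 + x *s r3) = 0"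
      unfolding rel by (simp_all add: area_def)
    then have ratio: "x * area r1 r3 = z * area r1 r2" "x * area r2 r3 = y * area r1 r2"
      "z * area r2 r3 = y * area r1 r3"
      by (simp_all add: area_def algebra_simps)
    obtain d where d: "area r1 r2 = d * x" "area r2 r3 = d * y" "area r1 r3 = d * z"
    proof -
      consider "x \<noteq> 0" | "y \<noteq> 0" | "z \<noteq> 0"
        using nz by blast
      then show thesis
      proof cases
        case 1
        then show ?thesis
          using ratio by (intro that[of "area r1 r2 / x"]) (simp_all add: field_simps)
      next
        case 2
        then show ?thesis
          using ratio by (intro that[of "area r2 r3 / y"]) (simp_all add: field_simps)
      next
        case 3
        then show ?thesis
          using ratio by (intro that[of "area r1 r3 / z"]) (simp_all add: field_simps)
      qed
    qed
    have area_R: "area r1 (R *v w) = d * (x * w$1 + z * w$2)"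
      "area r2 (R *v w) = d * (y * w$2 - x * w$0)" "area r3 (R *v w) = - d * (z * w$0 + y * w$1)" for w
    proof -
      have "area r1 (R *v w) = area r1 r2 * w$1 + area r1 r3 * w$2"
        "area r2 (R *v w) = area r2 r3 * w$2 - area r1 r2 * w$0"
        "area r3 (R *v w) = - (area r1 r3 * w$0 + area r2 r3 * w$1)"
        by (simp_all add: R area_def algebra_simps)
      then show "area r1 (R *v w) = d * (x * w$1 + z * w$2)"
        "area r2 (R *v w) = d * (y * w$2 - x * w$0)" "area r3 (R *v w) = - d * (z * w$0 + y * w$1)"
        by (simp_all add: d algebra_simps)
    qed
    have "d \<noteq> 0"
    proof
      assume "d = 0"
      have "area (R *v v) (R *v w) = (v$0 * w$1 - v$1 * w$0) * area r1 r2
          + (v$0 * w$2 - v$2 * w$0) * area r1 r3 + (v$1 * w$2 - v$2 * w$1) * area r2 r3" for v w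
        by (simp add: R area_def algebra_simps)
      then have "area (R *v v) (R *v w) = 0" for v w
        by (simp add: d \<open>d = 0\<close>)
      moreover obtain v w where "R *v v = vector [1, 0]" "R *v w = vector [0, 1]"
        using surj by (metis surjD)
      ultimately have "area (vector [1, 0]) (vector [0, 1]) = 0"
        by metis
      then show False
        by (simp add: area_def)
    qed
    define s where "s = csqrt d"
    have s: "s \<noteq> 0" "s * s = d"
      using \<open>d \<noteq> 0\<close> by (simp_all add: s_def flip: power2_eq_square)
    have inv: "inverse s * inverse s = inverse d"
      by (simp flip: s(2))
    have area_s: "area (inverse s *s u) (inverse s *s v) = area u v / d" for u v
    proof -
      have "area (inverse s *s u) (inverse s *s v) = inverse s * inverse s * area u v"
        by (simp add: area_def algebra_simps)
      then show ?thesis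
        by (simp only: inv divide_inverse mult.commute)
    qed
    have transv: "transvection (inverse s *s u) *v v = v - (area u v / d) *s u" for u v
    proof -
      have "transvection (inverse s *s u) *v v = v - (inverse s * inverse s * area u v) *s u"
        by (simp add: transvection_apply area_def vec_eq_iff algebra_simps)
      then show ?thesis
        by (simp only: inv divide_inverse mult.commute)
    qed
    have area_div: "area r1 (R *v w) / d = x * w$1 + z * w$2"
      "area r2 (R *v w) / d = y * w$2 - x * w$0" "area r3 (R *v w) / d = - (z * w$0 + y * w$1)" for w
      using \<open>d \<noteq> 0\<close> by (simp_all only: area_R) simp_all
    have "B1 *v v = transvection (inverse s *s r1) *v v" "B2 *v v = transvection (inverse s *s r2) *v v"
      "B3 *v v = transvection (inverse s *s r3) *v v" for v
    proof -
      obtain w where v: "v = R *v w"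
        using surj by (metis surjD)
      show "B1 *v v = transvection (inverse s *s r1) *v v" "B2 *v v = transvection (inverse s *s r2) *v v"
        "B3 *v v = transvection (inverse s *s r3) *v v"
        unfolding v transv area_div B r1_def[symmetric] r2_def[symmetric] r3_def[symmetric]
        by (simp_all add: vec_eq_iff algebra_simps)
    qed
    then have "B1 = transvection (inverse s *s r1)" "B2 = transvection (inverse s *s r2)"
      "B3 = transvection (inverse s *s r3)"
      by (simp_all add: matrix_eq)
    moreover have "area (inverse s *s r1) (inverse s *s r2) = x" "area (inverse s *s r2) (inverse s *s r3) = y"
      "area (inverse s *s r1) (inverse s *s r3) = z"
      using \<open>d \<noteq> 0\<close> by (simp_all add: area_s d)
    ultimately show ?thesis
      by blast
  qed
  have from_transvections: "\<exists>R. ?quot R"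
    if u: "area u1 u2 = x" "area u2 u3 = y" "area u1 u3 = z"
      and B: "B1 = transvection u1" "B2 = transvection u2" "B3 = transvection u3" for u1 u2 u3
  proof -
    define R :: "(complex, 3) vec^2" where "R = (\<chi> i k. triple u1 u2 u3 k $ i)"
    have col: "column 0 R = u1" "column 1 R = u2" "column 2 R = u3"
      using neq by (simp_all add: R_def column_def triple_def vec_eq_iff)
    have area_R: "area u1 (R *v w) = x * w$1 + z * w$2" "area u2 (R *v w) = y * w$2 - x * w$0"
       "area u3 (R *v w) = - (z * w$0 + y * w$1)" for w
      unfolding u[symmetric] by (simp_all add: R_apply col area_def algebra_simps)
    have some_area_nz: "area u1 u2 \<noteq> 0 \<or> area u2 u3 \<noteq> 0 \<or> area u1 u3 \<noteq> 0"
      using nz u by auto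
    then have surj: "surj ((*v) R)"
      using surj_if_area_nonzero[where R = R] unfolding col[symmetric] by blast
    have ker: "R *v w = 0 \<longleftrightarrow> - (x * w$1 + z * w$2) = 0 \<and> x * w$0 - y * w$2 = 0 \<and> z * w$0 + y * w$1 = 0" for w
    proof
      assume "R *v w = 0"
      then have "area u1 (R *v w) = 0" "area u2 (R *v w) = 0" "area u3 (R *v w) = 0"
        by (simp_all add: area_def)
      then show "- (x * w$1 + z * w$2) = 0 \<and> x * w$0 - y * w$2 = 0 \<and> z * w$0 + y * w$1 = 0"
        by (simp add: area_R neg_eq_iff_add_eq_0)
    next
      assume "- (x * w$1 + z * w$2) = 0 \<and> x * w$0 - y * w$2 = 0 \<and> z * w$0 + y * w$1 = 0"
      then have "x * w$1 + z * w$2 = 0" "x * w$0 - y * w$2 = 0" "z * w$0 + y * w$1 = 0"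
        by (simp_all only: neg_equal_0_iff_equal)
      then have "area u1 (R *v w) = 0" "area u2 (R *v w) = 0" "area u3 (R *v w) = 0"
        unfolding area_R by simp_all
      then show "R *v w = 0"
        using some_area_nz by (elim disjE) (erule area_kernel_trivial; assumption)+
    qed
    have act: "B1 *v (R *v w) = R *v w + (- (x * w$1 + z * w$2)) *s column 0 R"
      "B2 *v (R *v w) = R *v w + (x * w$0 - y * w$2) *s column 1 R"
      "B3 *v (R *v w) = R *v w + (z * w$0 + y * w$1) *s column 2 R" for w
      unfolding B transvection_apply area_R col by (simp_all add: vec_eq_iff algebra_simps)
    have "?quot R"
      by (intro conjI allI surj ker act)
    then show ?thesis ..
  qed
  have "(\<exists>R. ?quot R) \<longleftrightarrow> (\<exists>u1 u2 u3. area u1 u2 = x \<and> area u2 u3 = y \<and> area u1 u3 = z \<and>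
      B1 = transvection u1 \<and> B2 = transvection u2 \<and> B3 = transvection u3)"
  proof
    assume "\<exists>R. ?quot R"
    then obtain R where "?quot R" ..
    then show "\<exists>u1 u2 u3. area u1 u2 = x \<and> area u2 u3 = y \<and> area u1 u3 = z \<and>
        B1 = transvection u1 \<and> B2 = transvection u2 \<and> B3 = transvection u3"
      by (rule to_transvections)
  next
    assume "\<exists>u1 u2 u3. area u1 u2 = x \<and> area u2 u3 = y \<and> area u1 u3 = z \<and>
      B1 = transvection u1 \<and> B2 = transvection u2 \<and> B3 = transvection u3"
    then show "\<exists>R. ?quot R"
      by (elim exE conjE) (rule from_transvections)
  qed
  then show ?thesis
    by (simp only: phi)
qed

section \<open>Fricke parameters of the two kinds of tuples\<close>

lemma trace_inverse_pair:
  fixes M N :: "complex^2^2"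
  assumes "M ** N = mat 1"
  shows "trace M = det M * trace N"
proof -
  have "M$1$1 * N$1$1 + M$1$2 * N$2$1 = 1" "M$1$1 * N$1$2 + M$1$2 * N$2$2 = 0"
    "M$2$1 * N$1$1 + M$2$2 * N$2$1 = 0" "M$2$1 * N$1$2 + M$2$2 * N$2$2 = 1"
    using assms by (simp_all add: mat2_simps)
  then show ?thesis
    unfolding trace_def det_2 sum_2 by algebra
qed

lemma det_inverse_pair:
  fixes M N :: "complex^2^2"
  assumes "M ** N = mat 1"
  shows "det M * det N = 1"
  by (metis assms det_I det_mul)

lemma matrix_inv_right_if_det:
  fixes M :: "complex^2^2"
  assumes "det M \<noteq> 0"
  shows "M ** matrix_inv M = mat 1"
proof -
  have "\<exists>N. M ** N = mat 1 \<and> N ** M = mat 1"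
    using assms by (simp flip: invertible_det_nz add: invertible_def)
  then show ?thesis
    unfolding matrix_inv_def by (rule someI2_ex) blast
qed

lemma invertible_with_root_of_unity_eigenvalues_iff:
  fixes M :: "complex^2^2"
  assumes "det M \<noteq> 0"
  shows "invertible M \<and> (\<forall>c. eigenvalue M c \<longrightarrow> root_of_unity c) \<longleftrightarrow>
    (\<forall>c. c^2 - trace M * c + det M = 0 \<longrightarrow> root_of_unity c)"
  using assms by (simp add: eigenvalue_iff_char_poly invertible_det_nz)

text \<open>
  The determinant of \<open>A\<^sub>4\<close> is \<open>-1\<close>, so the condition on its eigenvalues is a condition on its trace.
\<close>

lemma involution_tuples_iff:
  "(A1, A2, A3, A4) \<in> involution_tuples \<longleftrightarrow> A1 ** A2 ** A3 ** A4 = mat 1 \<and>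
    (\<forall>M\<in>{A1, A2, A3}. trace M = 0 \<and> det M = -1) \<and>
    (\<forall>c. c^2 - trace A4 * c - 1 = 0 \<longrightarrow> root_of_unity c)"
proof (cases "A1 ** A2 ** A3 ** A4 = mat 1 \<and> (\<forall>M\<in>{A1, A2, A3}. trace M = 0 \<and> det M = -1)")
  case True
  then have A: "trace A1 = 0" "trace A2 = 0" "trace A3 = 0" "det A1 = -1" "det A2 = -1" "det A3 = -1"
    by simp_all
  have "det (A1 ** A2 ** A3) = -1"
    by (simp add: det_mul A)
  then have det4: "det A4 = -1"
    using det_inverse_pair[of "A1 ** A2 ** A3" A4] True by (simp add: minus_equation_iff)
  have inv: "invertible M \<and> (\<forall>c. eigenvalue M c \<longrightarrow> root_of_unity c)"
    if "M \<in> {A1, A2, A3}" for M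
  proof -
    have "root_of_unity c" if "c^2 - 0 * c + (-1) = 0" for c :: complex
      using that unfolding root_of_unity_def by (intro exI[of _ 2]) simp
    moreover have "trace M = 0" "det M = -1"
      using that A by auto
    ultimately show ?thesis
      by (subst invertible_with_root_of_unity_eigenvalues_iff) simp_all
  qed
  have "invertible A4 \<and> (\<forall>c. eigenvalue A4 c \<longrightarrow> root_of_unity c) \<longleftrightarrow>
    (\<forall>c. c^2 - trace A4 * c - 1 = 0 \<longrightarrow> root_of_unity c)"
    by (subst invertible_with_root_of_unity_eigenvalues_iff) (simp_all add: det4)
  then show ?thesis
    using True inv[of A1] inv[of A2] inv[of A3]
    unfolding involution_tuples_def by (simp add: noncentral_involution_iff)
next
  case False
  then show ?thesis
    unfolding involution_tuples_def by (auto simp: noncentral_involution_iff)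
qed

lemma unipotent_tuples_iff:
  "(B1, B2, B3, B4) \<in> unipotent_tuples \<longleftrightarrow> B1 ** B2 ** B3 ** B4 = mat 1 \<and>
    (\<forall>M\<in>{B1, B2, B3}. trace M = 2 \<and> det M = 1) \<and>
    (\<forall>c. c^2 - trace B4 * c + 1 = 0 \<longrightarrow> root_of_unity c)"
proof (cases "B1 ** B2 ** B3 ** B4 = mat 1 \<and> (\<forall>M\<in>{B1, B2, B3}. trace M = 2 \<and> det M = 1)")
  case True
  then have B: "trace B1 = 2" "trace B2 = 2" "trace B3 = 2" "det B1 = 1" "det B2 = 1" "det B3 = 1"
    by simp_all
  have "det (B1 ** B2 ** B3) = 1"
    by (simp add: det_mul B)
  then have det4: "det B4 = 1"
    using det_inverse_pair[of "B1 ** B2 ** B3" B4] True by simp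
  have inv: "invertible M \<and> (\<forall>c. eigenvalue M c \<longrightarrow> root_of_unity c)"
    if "M \<in> {B1, B2, B3}" for M
  proof -
    have "root_of_unity c" if "c^2 - 2 * c + 1 = 0" for c :: complex
    proof -
      have "(c - 1)^2 = 0"
        using that by (simp add: power2_eq_square algebra_simps)
      then show ?thesis
        unfolding root_of_unity_def by (intro exI[of _ 1]) simp
    qed
    moreover have "trace M = 2" "det M = 1"
      using that B by auto
    ultimately show ?thesis
      by (subst invertible_with_root_of_unity_eigenvalues_iff) simp_all
  qed
  have "invertible B4 \<and> (\<forall>c. eigenvalue B4 c \<longrightarrow> root_of_unity c) \<longleftrightarrow>
    (\<forall>c. c^2 - trace B4 * c + 1 = 0 \<longrightarrow> root_of_unity c)"
    by (subst invertible_with_root_of_unity_eigenvalues_iff) (simp_all add: det4)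
  then show ?thesis
    using True inv[of B1] inv[of B2] inv[of B3] det4
    unfolding unipotent_tuples_def by (simp add: unipotent_iff)
next
  case False
  then show ?thesis
    unfolding unipotent_tuples_def by (auto simp: unipotent_iff)
qed

text \<open>
  The Gram determinant identity, together with \<open>trace (A\<^sub>1 A\<^sub>2 A\<^sub>3) = - trace A\<^sub>4\<close>.
\<close>

lemma involution_tuple_relation:
  assumes "(A1, A2, A3, A4) \<in> involution_tuples"
  defines "x \<equiv> trace (A1 ** A2)" and "y \<equiv> trace (A2 ** A3)" and "z \<equiv> trace (A1 ** A3)"
  shows "(trace A4)^2 = x^2 + y^2 + z^2 - x * y * z - 4"
proof -
  have A: "A1 ** A2 ** A3 ** A4 = mat 1" "trace A1 = 0" "trace A2 = 0" "trace A3 = 0"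
    "det A1 = -1" "det A2 = -1" "det A3 = -1"
    using assms(1) by (simp_all add: involution_tuples_iff)
  have "trace (A1 ** A2 ** A3) = - trace A4"
    using trace_inverse_pair[OF A(1)] by (simp add: det_mul A)
  then show ?thesis
    using trace_triple_product_square[OF A(2-4)] by (simp add: A x_def y_def z_def)
qed

text \<open>
  The Gram determinant identity for the nilpotent matrices \<open>B\<^sub>i - 1\<close>: their triple trace \<open>t\<close> satisfies
  \<open>t\<^sup>2 = x\<^sup>2 y\<^sup>2 z\<^sup>2\<close>, and changing the square root \<open>x\<close> if necessary gives \<open>t = x y z\<close>.
\<close>

lemma unipotent_tuple_relation:
  assumes "(B1, B2, B3, B4) \<in> unipotent_tuples"
  obtains x y z where "trace (B1 ** B2) = 2 - x^2" "trace (B2 ** B3) = 2 - y^2"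
    "trace (B1 ** B3) = 2 - z^2" "trace B4 = 2 - x^2 - y^2 - z^2 + x * y * z"
proof -
  have B: "B1 ** B2 ** B3 ** B4 = mat 1" "trace B1 = 2" "trace B2 = 2" "trace B3 = 2"
    "det B1 = 1" "det B2 = 1" "det B3 = 1"
    using assms(1) by (simp_all add: unipotent_tuples_iff)
  have nil: "trace (M - mat 1) = trace M - 2" "det (M - mat 1) = det M - trace M + 1" for M :: "complex^2^2"
    by (simp_all add: mat2_simps algebra_simps)
  have two: "trace ((M - mat 1) ** (N - mat 1)) = trace (M ** N) - trace M - trace N + 2"
    for M N :: "complex^2^2"
    by (simp add: mat2_simps algebra_simps)
  have three: "trace ((B1 - mat 1) ** (B2 - mat 1) ** (B3 - mat 1)) = trace (B1 ** B2 ** B3)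
     - trace (B1 ** B2) - trace (B2 ** B3) - trace (B1 ** B3) + trace B1 + trace B2 + trace B3 - 2"
    by (simp add: mat2_simps algebra_simps)
  have tr4: "trace (B1 ** B2 ** B3) = trace B4"
    using trace_inverse_pair[OF B(1)] by (simp add: det_mul B)
  define t where "t = trace ((B1 - mat 1) ** (B2 - mat 1) ** (B3 - mat 1))"
  define x y z where "x = csqrt (2 - trace (B1 ** B2))" and "y = csqrt (2 - trace (B2 ** B3))"
    and "z = csqrt (2 - trace (B1 ** B3))"
  have "x^2 = 2 - trace (B1 ** B2)" "y^2 = 2 - trace (B2 ** B3)" "z^2 = 2 - trace (B1 ** B3)"
    by (simp_all add: x_def y_def z_def)
  then have tr: "trace (B1 ** B2) = 2 - x^2" "trace (B2 ** B3) = 2 - y^2" "trace (B1 ** B3) = 2 - z^2"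
    by simp_all
  have b: "trace B4 = 2 - x^2 - y^2 - z^2 + t"
    unfolding t_def three B tr tr4 by simp
  have "t^2 = (x * y * z)^2"
    unfolding t_def
    by (subst trace_triple_product_square) (simp_all add: nil two B tr power_mult_distrib)
  then consider "t = x * y * z" | "t = (- x) * y * z"
    by (auto simp: power2_eq_iff)
  then show thesis
  proof cases
    case 1
    then show ?thesis
      using that[of x y z] tr b by simp
  next
    case 2
    then show ?thesis
      using that[of "- x" y z] tr b by simp
  qed
qed

text \<open>
  The matrix with rows \<open>(P, R)\<close> and \<open>(T, Q)\<close> is singular, hence the product of a column \<open>(b, e)\<close> and a
  row \<open>(f, c)\<close>.
\<close>

lemma rank_one_factorization:
  fixes P Q R T :: complex
  assumes "R * T = P * Q"
  obtains b c e f where "b * c = R" "e * f = T" "b * f = P" "c * e = Q"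
proof -
  have "R = 0 \<Longrightarrow> P = 0 \<or> Q = 0"
    using assms by auto
  then consider "R \<noteq> 0" | "R = 0" "T \<noteq> 0" | "R = 0" "T = 0" "Q = 0" | "R = 0" "T = 0" "P = 0"
    by blast
  then show thesis
  proof cases
    case 1
    then show ?thesis
      using assms by (intro that[of 1 R "Q / R" P]) (simp_all add: field_simps)
  next
    case 2
    then show ?thesis
      using assms by (intro that[of P "Q / T" T 1]) auto
  next
    case 3
    then show ?thesis
      by (intro that[of 1 0 0 P]) auto
  next
    case 4
    then show ?thesis
      by (intro that[of 0 1 Q 0]) auto
  qed
qed

text \<open>
  With the first involution diagonal, the traces of products determine the diagonals of the other two.
  The off-diagonal entries \<open>b, c\<close> and \<open>e, f\<close> of these enter the determinants and the remaining traces
  through the products \<open>b c\<close>, \<open>e f\<close>, \<open>b f\<close>, \<open>c e\<close>, and the relation between the parameters is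
  precisely the consistency condition for prescribing these products.
\<close>

lemma involution_tuple_exists:
  assumes rel: "a^2 = x^2 + y^2 + z^2 - x * y * z - 4"
    and roots: "\<forall>c. c^2 - a * c - 1 = 0 \<longrightarrow> root_of_unity c"
  shows "(0, 0, 0, a, x, y, z) \<in> fricke ` involution_tuples"
proof -
  define P Q where "P = (y - x * z / 2 - a) / 2" and "Q = (y - x * z / 2 + a) / 2"
  have PQ: "2 * (P + Q) = 2 * y - x * z" "P - Q = - a"
    by (simp_all add: P_def Q_def field_simps)
  have "16 * ((1 - x^2 / 4) * (1 - z^2 / 4)) = (4 - x^2) * (4 - z^2)"
    by (simp add: algebra_simps)
  also have "\<dots> = 16 * (P * Q)"
    using PQ rel by algebra
  finally have "(1 - x^2 / 4) * (1 - z^2 / 4) = P * Q"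
    by simp
  then obtain b c e f where bc: "b * c = 1 - x^2 / 4" and ef: "e * f = 1 - z^2 / 4"
    and bf: "b * f = P" and ce: "c * e = Q"
    by (rule rank_one_factorization)
  define A1 A2 A3 :: "complex^2^2" where "A1 = vector [vector [1, 0], vector [0, -1]]"
    and "A2 = vector [vector [x / 2, b], vector [c, - x / 2]]"
    and "A3 = vector [vector [z / 2, e], vector [f, - z / 2]]"
  define A4 where "A4 = matrix_inv (A1 ** A2 ** A3)"
  have tr: "trace A1 = 0" "trace A2 = 0" "trace A3 = 0"
    by (simp_all add: A1_def A2_def A3_def mat2_simps)
  have "det A2 = - (x^2 / 4) - b * c" "det A3 = - (z^2 / 4) - e * f"
    by (simp_all add: A2_def A3_def det_2 power2_eq_square)
  then have dt: "det A1 = -1" "det A2 = -1" "det A3 = -1"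
    by (simp_all add: A1_def det_2 bc ef)
  have A: "A1 ** A2 ** A3 ** A4 = mat 1"
    unfolding A4_def by (rule matrix_inv_right_if_det) (simp add: det_mul dt)
  have "trace (A1 ** A2 ** A3) = b * f - c * e"
    by (simp add: mat2_simps A1_def A2_def A3_def)
  also have "\<dots> = - a"
    by (simp add: bf ce PQ)
  finally have a: "trace A4 = a"
    using trace_inverse_pair[OF A] by (simp add: det_mul dt)
  have "2 * trace (A2 ** A3) = x * z + 2 * (b * f + c * e)"
    by (simp add: mat2_simps A2_def A3_def)
  also have "\<dots> = 2 * y"
    unfolding bf ce PQ by simp
  finally have y: "trace (A2 ** A3) = y"
    by simp
  have xz: "trace (A1 ** A2) = x" "trace (A1 ** A3) = z"
    by (simp_all add: mat2_simps A1_def A2_def A3_def)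
  have "(A1, A2, A3, A4) \<in> involution_tuples"
    using A tr dt a roots by (simp add: involution_tuples_iff)
  moreover have "fricke (A1, A2, A3, A4) = (0, 0, 0, a, x, y, z)"
    by (simp add: tr a y xz)
  ultimately show ?thesis
    by (metis imageI)
qed

lemma transvections_with_areas_exist:
  obtains u1 u2 u3 where "area u1 u2 = x" "area u2 u3 = y" "area u1 u3 = z"
proof -
  consider "x \<noteq> 0" | "x = 0" "z \<noteq> 0" | "x = 0" "z = 0"
    by blast
  then show thesis
  proof cases
    case 1
    then show ?thesis
      by (intro that[of "vector [1, 0]" "vector [0, x]" "vector [- y / x, z]"]) (simp_all add: area_def)
  next
    case 2
    then show ?thesis
      by (intro that[of "vector [1, 0]" "vector [y / z, 0]" "vector [0, z]"]) (simp_all add: area_def)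
  next
    case 3
    then show ?thesis
      by (intro that[of 0 "vector [1, 0]" "vector [0, y]"]) (simp_all add: area_def)
  qed
qed

lemma transvection_entries:
  "transvection u $ 1 $ 1 = 1 + u$1 * u$2" "transvection u $ 1 $ 2 = - (u$1 * u$1)"
  "transvection u $ 2 $ 1 = u$2 * u$2" "transvection u $ 2 $ 2 = 1 - u$1 * u$2"
  by (simp_all add: transvection_def)

lemma transvection_traces:
  "trace (transvection u) = 2" "det (transvection u) = 1"
  "trace (transvection u ** transvection v) = 2 - (area u v)^2"
  "trace (transvection u ** transvection v ** transvection w) =
    2 - (area u v)^2 - (area v w)^2 - (area u w)^2 + area u v * area v w * area u w"
  by (simp_all only: trace_def det_2 sum_2 matrix_matrix_mult_def vec_lambda_beta
      transvection_entries area_def) (simp_all add: power2_eq_square algebra_simps)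

lemma transvection_tuple:
  assumes "area u1 u2 = x" "area u2 u3 = y" "area u1 u3 = z"
  defines "B1 \<equiv> transvection u1" and "B2 \<equiv> transvection u2" and "B3 \<equiv> transvection u3"
  defines "B4 \<equiv> matrix_inv (B1 ** B2 ** B3)"
  defines "b \<equiv> 2 - x^2 - y^2 - z^2 + x * y * z"
  assumes roots: "\<forall>c. c^2 - b * c + 1 = 0 \<longrightarrow> root_of_unity c"
  shows "(B1, B2, B3, B4) \<in> unipotent_tuples"
    and "fricke (B1, B2, B3, B4) = (2, 2, 2, b, 2 - x^2, 2 - y^2, 2 - z^2)"
proof -
  have dt: "det B1 = 1" "det B2 = 1" "det B3 = 1" and tr: "trace B1 = 2" "trace B2 = 2" "trace B3 = 2"
    by (simp_all add: B1_def B2_def B3_def transvection_traces)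
  have B: "B1 ** B2 ** B3 ** B4 = mat 1"
    unfolding B4_def by (rule matrix_inv_right_if_det) (simp add: det_mul dt)
  have "trace (B1 ** B2 ** B3) = b"
    by (simp add: B1_def B2_def B3_def transvection_traces assms(1-3) b_def)
  then have b: "trace B4 = b"
    using trace_inverse_pair[OF B] by (simp add: det_mul dt)
  show "(B1, B2, B3, B4) \<in> unipotent_tuples"
    using B dt tr b roots by (simp add: unipotent_tuples_iff)
  have "trace (B1 ** B2) = 2 - x^2" "trace (B2 ** B3) = 2 - y^2" "trace (B1 ** B3) = 2 - z^2"
    by (simp_all add: B1_def B2_def B3_def transvection_traces assms(1-3))
  then show "fricke (B1, B2, B3, B4) = (2, 2, 2, b, 2 - x^2, 2 - y^2, 2 - z^2)"
    by (simp add: tr b)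
qed

lemma root_of_unity_power_iff:
  assumes "k > 0"
  shows "root_of_unity (c^k) \<longleftrightarrow> root_of_unity c"
proof
  assume "root_of_unity (c^k)"
  then obtain m where "m > 0" "c^(k * m) = 1"
    by (auto simp: root_of_unity_def power_mult)
  then show "root_of_unity c"
    using assms unfolding root_of_unity_def by (intro exI[of _ "k * m"]) simp
next
  assume "root_of_unity c"
  then obtain m where "m > 0" "c^m = 1"
    by (auto simp: root_of_unity_def)
  then have "(c^k)^m = 1"
    by (metis mult.commute power_mult power_one)
  with \<open>m > 0\<close> show "root_of_unity (c^k)"
    unfolding root_of_unity_def by blast
qed

lemma root_of_unity_minus_iff: "root_of_unity (- c) \<longleftrightarrow> root_of_unity c"
  using root_of_unity_power_iff[of 2 c] root_of_unity_power_iff[of 2 "- c"] by simp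

lemma root_of_unity_inverse_iff: "root_of_unity (inverse c) \<longleftrightarrow> root_of_unity c"
  by (simp add: root_of_unity_def power_inverse)

text \<open>
  If \<open>c\<close> and \<open>- 1 / c\<close> are the roots of \<open>X\<^sup>2 - a X - 1\<close>, then \<open>- c\<^sup>2\<close> and \<open>- 1 / c\<^sup>2\<close> are those of
  \<open>X\<^sup>2 + (a\<^sup>2 + 2) X + 1\<close>.
\<close>

lemma roots_of_unity_transfer:
  "(\<forall>c. c^2 - (- (a^2) - 2) * c + 1 = 0 \<longrightarrow> root_of_unity c) \<longleftrightarrow>
    (\<forall>c. c^2 - a * c - 1 = 0 \<longrightarrow> root_of_unity c)"
proof (intro iffI allI impI)
  fix c assume roots: "\<forall>c. c^2 - (- (a^2) - 2) * c + 1 = 0 \<longrightarrow> root_of_unity c" and c: "c^2 - a * c - 1 = 0"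
  from c have "(- (c^2))^2 - (- (a^2) - 2) * (- (c^2)) + 1 = 0"
    by algebra
  then have "root_of_unity (- (c^2))"
    using roots by blast
  then show "root_of_unity c"
    by (simp add: root_of_unity_minus_iff root_of_unity_power_iff)
next
  fix d assume roots: "\<forall>c. c^2 - a * c - 1 = 0 \<longrightarrow> root_of_unity c" and d: "d^2 - (- (a^2) - 2) * d + 1 = 0"
  obtain c where c: "c^2 - a * c + (- 1) = 0"
    using monic_quadratic_has_root .
  then have rc: "root_of_unity c"
    using roots by simp
  have "(d + c^2) * (c^2 * d + 1) = 0"
    using c d by algebra
  then consider "d + c^2 = 0" | "c^2 * d + 1 = 0"
    by auto
  then show "root_of_unity d"
  proof cases
    case 1
    then have "d = - (c^2)"
      by (simp add: eq_neg_iff_add_eq_0)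
    then show ?thesis
      using rc by (simp add: root_of_unity_minus_iff root_of_unity_power_iff)
  next
    case 2
    then have "c^2 * (- d) = 1"
      by algebra
    then have "inverse (c^2) = - d"
      by (rule inverse_unique)
    moreover have "root_of_unity (inverse (c^2))"
      using rc by (simp add: root_of_unity_inverse_iff root_of_unity_power_iff)
    ultimately show ?thesis
      by (simp add: root_of_unity_minus_iff)
  qed
qed

text \<open>
  Both inclusions solve the relations between the parameters: with transvections of areas \<open>x, y, z\<close> in
  one direction, and with a square root \<open>a\<close> of \<open>- b - 2\<close> in the other.
\<close>

lemma phi_params_image:
  "phi_params ` fricke ` involution_tuples = fricke ` unipotent_tuples"
proof (intro Set.equalityI subsetI)
  fix p assume "p \<in> phi_params ` fricke ` involution_tuples"
  then obtain A1 A2 A3 A4 where A: "(A1, A2, A3, A4) \<in> involution_tuples"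
    and p: "p = phi_params (fricke (A1, A2, A3, A4))"
    by auto
  define x y z where "x = trace (A1 ** A2)" and "y = trace (A2 ** A3)" and "z = trace (A1 ** A3)"
  obtain u1 u2 u3 where u: "area u1 u2 = x" "area u2 u3 = y" "area u1 u3 = z"
    by (rule transvections_with_areas_exist)
  have b: "2 - x^2 - y^2 - z^2 + x * y * z = - ((trace A4)^2) - 2"
    using involution_tuple_relation[OF A] by (simp add: x_def y_def z_def)
  have roots: "\<forall>c. c^2 - (2 - x^2 - y^2 - z^2 + x * y * z) * c + 1 = 0 \<longrightarrow> root_of_unity c"
    unfolding b roots_of_unity_transfer using A by (simp add: involution_tuples_iff)
  have "p = (2, 2, 2, 2 - x^2 - y^2 - z^2 + x * y * z, 2 - x^2, 2 - y^2, 2 - z^2)"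
    unfolding b by (simp add: p flip: x_def y_def z_def)
  then show "p \<in> fricke ` unipotent_tuples"
    using transvection_tuple[OF u roots] by (metis imageI)
next
  fix p assume "p \<in> fricke ` unipotent_tuples"
  then obtain B1 B2 B3 B4 where B: "(B1, B2, B3, B4) \<in> unipotent_tuples"
    and p: "p = fricke (B1, B2, B3, B4)"
    by auto
  obtain x y z where xyz: "trace (B1 ** B2) = 2 - x^2" "trace (B2 ** B3) = 2 - y^2"
    "trace (B1 ** B3) = 2 - z^2" "trace B4 = 2 - x^2 - y^2 - z^2 + x * y * z"
    using unipotent_tuple_relation[OF B] .
  define a where "a = csqrt (- trace B4 - 2)"
  have a2: "a^2 = - trace B4 - 2"
    by (simp add: a_def)
  then have b: "trace B4 = - (a^2) - 2"
    by simp
  have "(0, 0, 0, a, x, y, z) \<in> fricke ` involution_tuples"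
  proof (rule involution_tuple_exists)
    show "a^2 = x^2 + y^2 + z^2 - x * y * z - 4"
      unfolding a2 xyz(4) by simp
    show "\<forall>c. c^2 - a * c - 1 = 0 \<longrightarrow> root_of_unity c"
      using B unfolding unipotent_tuples_iff b roots_of_unity_transfer by blast
  qed
  moreover have "p = phi_params (0, 0, 0, a, x, y, z)"
    using B xyz(1-3) by (simp add: p b unipotent_tuples_iff)
  ultimately show "p \<in> phi_params ` fricke ` involution_tuples"
    by blast
qed

section \<open>Irreducibility in terms of Fricke parameters\<close>

lemma common_eigenvector_trace:
  fixes X Y :: "complex^2^2"
  assumes "v \<noteq> 0" "area v (X *v v) = 0" "area v (Y *v v) = 0"
  obtains c d where "c^2 - trace X * c + det X = 0" "d^2 - trace Y * d + det Y = 0"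
    "(c * d)^2 - trace (X ** Y) * (c * d) + det X * det Y = 0"
proof -
  obtain c d where c: "X *v v = c *s v" and d: "Y *v v = d *s v"
    using assms area_eq_0_iff by blast
  have "(X ** Y) *v v = (c * d) *s v"
    by (simp add: c d vec.scale mult.commute flip: matrix_vector_mul_assoc)
  then have "eigenvalue X c" "eigenvalue Y d" "eigenvalue (X ** Y) (c * d)"
    using c d assms(1) unfolding eigenvalue_def by blast+
  then show thesis
    using that by (simp add: eigenvalue_iff_char_poly det_mul)
qed

lemma trace_diff_scaled:
  fixes X Y Z :: "complex^2^2"
  shows "trace (X - mat e ** Y) = trace X - e * trace Y"
    and "trace ((X - mat e ** Y) ** Z) = trace (X ** Z) - e * trace (Y ** Z)"
    and "det (X - mat e ** Y) = det X + e^2 * det Y - e * (trace X * trace Y - trace (X ** Y))"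
  by (simp_all add: mat2_simps algebra_simps power2_eq_square)

lemma trace_square_2: "trace (M ** M) = (trace M)^2 - 2 * det M"
  for M :: "complex^2^2"
  by (simp add: mat2_simps algebra_simps power2_eq_square)

text \<open>
  Here the Gram matrix of the trace form on \<open>A\<^sub>1, A\<^sub>2, A\<^sub>3\<close> has rank one. Subtracting from \<open>A\<^sub>2\<close> and \<open>A\<^sub>3\<close>
  the multiples of \<open>A\<^sub>1\<close> that make the differences orthogonal to \<open>A\<^sub>1\<close> leaves elements of the radical:
  they are nilpotent and orthogonal to all three involutions. If one of them is nonzero, its kernel is
  a common eigenline; otherwise the three involutions are proportional.
\<close>

lemma rank_one_gram_involutions_reducible:
  assumes A: "(A1, A2, A3, A4) \<in> involution_tuples"
    and sq: "(trace (A1 ** A2))^2 = 4" "(trace (A2 ** A3))^2 = 4" "(trace (A1 ** A3))^2 = 4"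
    and xyz: "trace (A1 ** A2) * trace (A2 ** A3) * trace (A1 ** A3) = 8"
  shows "\<not> irreducible_tuple (A1, A2, A3, A4)"
proof -
  define x y z where "x = trace (A1 ** A2)" and "y = trace (A2 ** A3)" and "z = trace (A1 ** A3)"
  have inv: "A1 ** A2 ** A3 ** A4 = mat 1" "trace A1 = 0" "trace A2 = 0" "trace A3 = 0"
    "det A1 = -1" "det A2 = -1" "det A3 = -1"
    using A by (simp_all add: involution_tuples_iff)
  have swap: "trace (A2 ** A1) = x" "trace (A3 ** A2) = y" "trace (A3 ** A1) = z"
    unfolding x_def y_def z_def by (rule trace_mul_sym)+
  have pairs: "trace (A1 ** A1) = 2" "trace (A2 ** A2) = 2" "trace (A3 ** A3) = 2"
    "trace (A1 ** A2) = x" "trace (A2 ** A3) = y" "trace (A1 ** A3) = z"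
    by (simp_all add: trace_square_2 inv x_def y_def z_def)
  have xyz': "x^2 = 4" "y^2 = 4" "z^2 = 4" "x * y * z = 8"
    using sq xyz by (simp_all add: x_def y_def z_def)
  have "4 * (2 * y) = (x * y * z) * y"
    by (simp add: xyz')
  also have "\<dots> = y^2 * (x * z)"
    by algebra
  finally have "2 * y = x * z"
    by (simp add: xyz')
  define N2 N3 where "N2 = A2 - mat (x / 2) ** A1" and "N3 = A3 - mat (z / 2) ** A1"
  have tr: "trace N2 = 0" "trace N3 = 0"
    by (simp_all add: N2_def N3_def trace_diff_scaled inv)
  have "4 * det N2 = x^2 - 4" "4 * det N3 = z^2 - 4"
    by (simp_all add: N2_def N3_def trace_diff_scaled inv pairs swap power2_eq_square)
  then have dt: "det N2 = 0" "det N3 = 0"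
    using xyz' by simp_all
  have "2 * trace (N2 ** A1) = 0" "2 * trace (N2 ** A2) = 4 - x^2" "2 * trace (N2 ** A3) = 2 * y - x * z"
    "2 * trace (N3 ** A1) = 0" "2 * trace (N3 ** A2) = 2 * y - x * z" "2 * trace (N3 ** A3) = 4 - z^2"
    by (simp_all add: N2_def N3_def trace_diff_scaled pairs swap power2_eq_square)
  then have ortho: "trace (N2 ** M) = 0" "trace (N3 ** M) = 0" if "M \<in> {A1, A2, A3}" for M
    using that xyz' \<open>2 * y = x * z\<close> by auto
  have "\<exists>v. v \<noteq> 0 \<and> (\<forall>M\<in>{A1, A2, A3}. area v (M *v v) = 0)"
  proof -
    consider "N2 \<noteq> 0" | "N3 \<noteq> 0" | "N2 = 0" "N3 = 0"
      by blast
    then show ?thesis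
    proof cases
      case 1
      then show ?thesis
        using nilpotent_kernel_is_eigenline[OF tr(1) dt(1)] ortho(1) by metis
    next
      case 2
      then show ?thesis
        using nilpotent_kernel_is_eigenline[OF tr(2) dt(2)] ortho(2) by metis
    next
      case 3
      have "eigenvalue A1 1"
        by (simp add: eigenvalue_iff_char_poly inv)
      then obtain v where v: "v \<noteq> 0" "A1 *v v = v"
        unfolding eigenvalue_def by auto
      have scaled: "(mat e ** A1) *v v = e *s v" for e
      proof -
        have "(mat e ** A1) *v v = e *s (A1 *v v)"
          by (simp add: mat2_simps algebra_simps)
        then show ?thesis
          by (simp only: v(2))
      qed
      have "A2 *v v = (x / 2) *s v" "A3 *v v = (z / 2) *s v"
        using 3 scaled by (simp_all add: N2_def N3_def)
      then show ?thesis
        using v by (intro exI[of _ v]) (auto simp: area_def)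
    qed
  qed
  then show ?thesis
    by (simp only: irreducible_iff_no_common_eigenvector[OF inv(1)] not_not)
qed

lemma root_of_unity_norm:
  assumes "root_of_unity c"
  shows "norm c = 1"
proof -
  obtain m where m: "m > 0" "c^m = 1"
    using assms unfolding root_of_unity_def by blast
  then have "norm c ^ m = 1 ^ m"
    by (simp flip: norm_power)
  then show ?thesis
    by (rule power_eq_imp_eq_base) (simp_all add: m)
qed

text \<open>
  If the roots lie on the unit circle, then \<open>a = c - 1 / c\<close> has absolute value at most \<open>2\<close>.
\<close>

lemma not_all_roots_of_unity_16:
  "\<not> (\<forall>c. c^2 - a * c - 1 = 0 \<longrightarrow> root_of_unity c)" if a: "a^2 = 16"
proof
  assume roots: "\<forall>c. c^2 - a * c - 1 = 0 \<longrightarrow> root_of_unity c"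
  obtain c where c: "c^2 - a * c + (- 1) = 0"
    using monic_quadratic_has_root .
  then have "norm c = 1"
    using roots root_of_unity_norm by simp
  moreover have "a * c = c^2 - 1"
    using c by (simp add: algebra_simps)
  ultimately have "norm a = norm (c^2 - 1)"
    by (metis mult.right_neutral norm_mult)
  also have "\<dots> \<le> norm (c^2) + norm (1::complex)"
    by (rule norm_triangle_ineq4)
  also have "\<dots> = 2"
    by (simp add: norm_power \<open>norm c = 1\<close>)
  finally have "(norm a)^2 \<le> 2^2"
    by (rule power_mono) simp
  moreover have "(norm a)^2 = 16"
    using a by (simp flip: norm_power)
  ultimately show False
    by simp
qed

text \<open>
  The relation becomes \<open>a\<^sup>2 = 8 - x y z\<close> with \<open>x y z = 8\<close> or \<open>x y z = - 8\<close>, and in the second case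
  \<open>a\<^sup>2 = 16\<close> is too large for roots of unity.
\<close>

lemma involution_params_all_squares_4:
  assumes A: "(A1, A2, A3, A4) \<in> involution_tuples"
    and sq: "(trace (A1 ** A2))^2 = 4" "(trace (A2 ** A3))^2 = 4" "(trace (A1 ** A3))^2 = 4"
  shows "trace A4 = 0" and "trace (A1 ** A2) * trace (A2 ** A3) * trace (A1 ** A3) = 8"
proof -
  define t where "t = trace (A1 ** A2) * trace (A2 ** A3) * trace (A1 ** A3)"
  have a: "(trace A4)^2 = 8 - t"
    using involution_tuple_relation[OF A] by (simp add: sq t_def)
  have "t^2 = 8^2"
    by (simp add: t_def power_mult_distrib sq)
  moreover have "t \<noteq> - 8"
    using a not_all_roots_of_unity_16[of "trace A4"] A by (auto simp: involution_tuples_iff)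
  ultimately have "t = 8"
    by (simp only: power2_eq_iff) blast
  then show "trace (A1 ** A2) * trace (A2 ** A3) * trace (A1 ** A3) = 8"
    by (simp add: t_def)
  show "trace A4 = 0"
    using a \<open>t = 8\<close> by simp
qed

lemma anticommute_if_trace_0:
  fixes X Y :: "complex^2^2"
  assumes "trace X = 0" "trace Y = 0" "trace (X ** Y) = 0"
  shows "X *v (Y *v v) = - (Y *v (X *v v))"
proof -
  have e: "X$2$2 = - X$1$1" "Y$2$2 = - Y$1$1"
    using assms(1,2) by (simp_all add: trace_def sum_2 eq_neg_iff_add_eq_0 add.commute)
  have "X ** Y + Y ** X = mat (trace (X ** Y))"
    by (simp add: mat2_simps e algebra_simps)
  then have "X ** Y + Y ** X = 0"
    by (simp add: assms(3))
  then have "X *v (Y *v v) + Y *v (X *v v) = 0"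
    by (simp add: matrix_vector_mul_assoc flip: matrix_vector_mult_add_rdistrib)
  then show ?thesis
    by (simp add: eq_neg_iff_add_eq_0)
qed

text \<open>
  The product \<open>A\<^sub>1 A\<^sub>2 A\<^sub>3\<close> of anticommuting involutions commutes with \<open>A\<^sub>1\<close> and \<open>A\<^sub>2\<close>, which have no
  common eigenvector. As in Schur's lemma, these matrices preserve its eigenspaces, so it is a scalar.
\<close>

lemma anticommuting_involutions_product_central:
  assumes A: "(A1, A2, A3, A4) \<in> involution_tuples"
    and zero: "trace (A1 ** A2) = 0" "trace (A2 ** A3) = 0" "trace (A1 ** A3) = 0"
  shows "central_GL A4"
proof -
  have inv: "A1 ** A2 ** A3 ** A4 = mat 1" "trace A1 = 0" "trace A2 = 0" "trace A3 = 0"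
    "det A1 = -1" "det A2 = -1" "det A3 = -1"
    using A by (simp_all add: involution_tuples_iff)
  note anti = anticommute_if_trace_0[OF inv(2,3) zero(1)] anticommute_if_trace_0[OF inv(3,4) zero(2)]
    anticommute_if_trace_0[OF inv(2,4) zero(3)]
  have neg: "M *v (- u) = - (M *v u)" for M :: "complex^2^2" and u
    by (rule vec.neg)
  define M where "M = A1 ** A2 ** A3"
  have M: "M *v u = A1 *v (A2 *v (A3 *v u))" for u
    by (simp add: M_def flip: matrix_vector_mul_assoc)
  have comm: "M *v (A1 *v u) = A1 *v (M *v u)" "M *v (A2 *v u) = A2 *v (M *v u)" for u
  proof -
    have "A3 *v (A1 *v u) = - (A1 *v (A3 *v u))" "A2 *v (A1 *v w) = - (A1 *v (A2 *v w))"
      "A3 *v (A2 *v u) = - (A2 *v (A3 *v u))" for w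
      using anti[of u] anti[of w] by simp_all
    then show "M *v (A1 *v u) = A1 *v (M *v u)" "M *v (A2 *v u) = A2 *v (M *v u)"
      by (simp_all add: M neg)
  qed
  obtain c where "c^2 - trace M * c + det M = 0"
    using monic_quadratic_has_root .
  then obtain v where v: "v \<noteq> 0" "M *v v = c *s v"
    using eigenvalue_iff_char_poly unfolding eigenvalue_def by blast
  have "\<exists>u. area v u \<noteq> 0 \<and> M *v u = c *s u"
  proof (rule ccontr)
    assume no: "\<nexists>u. area v u \<noteq> 0 \<and> M *v u = c *s u"
    have "M *v (A1 *v v) = c *s (A1 *v v)" "M *v (A2 *v v) = c *s (A2 *v v)"
      by (simp_all add: comm v vec.scale)
    then have "area v (A1 *v v) = 0" "area v (A2 *v v) = 0"
      using no by blast+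
    then obtain c1 c2 where "c1^2 - trace A1 * c1 + det A1 = 0" "c2^2 - trace A2 * c2 + det A2 = 0"
      "(c1 * c2)^2 - trace (A1 ** A2) * (c1 * c2) + det A1 * det A2 = 0"
      using common_eigenvector_trace v(1) by metis
    then show False
      by (simp add: inv zero power_mult_distrib)
  qed
  then obtain u where u: "area v u \<noteq> 0" "M *v u = c *s u"
    by blast
  have "M *v w = c *s w" for w
  proof -
    have "area v u *s (M *v w) = M *v (area v u *s w)"
      by (simp add: vec.scale)
    also have "\<dots> = area w u *s (M *v v) + area v w *s (M *v u)"
      by (simp only: area_expansion[of v u w] matrix_vector_right_distrib vec.scale)
    also have "\<dots> = c *s (area w u *s v + area v w *s u)"
      by (simp add: v u vec_eq_iff algebra_simps)
    also have "\<dots> = c *s (area v u *s w)"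
      by (simp only: area_expansion[of v u w])
    finally have "area v u *s (M *v w) = area v u *s (c *s w)"
      by (simp add: mult.commute)
    then show ?thesis
      using u(1) by (simp only: vec.scale_left_imp_eq)
  qed
  moreover have "mat c *v w = c *s w" for w :: "complex^2"
    by (simp add: mat2_simps)
  ultimately have "M = mat c"
    by (simp add: matrix_eq)
  then have one: "mat c ** A4 = mat 1"
    using inv(1) by (simp only: M_def)
  then have "c \<noteq> 0"
    by (auto simp: mat2_simps)
  then have "mat (inverse c) ** (mat c ** A4) = A4"
    by (simp add: mat2_simps)
  then have "A4 = mat (inverse c)"
    unfolding one by simp
  then show ?thesis
    unfolding central_GL_iff by blast
qed

text \<open>
  For the direction from right to left: on a common eigenvector the involutions act by signs, so
  \<open>A\<^sub>i A\<^sub>j\<close>, of determinant \<open>1\<close>, has a double eigenvalue \<open>1\<close> or \<open>-1\<close> and trace \<open>2\<close> or \<open>-2\<close>. If \<open>A\<^sub>4\<close>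
  is a scalar, the product of any two of the involutions is proportional to the third and has trace
  zero.
\<close>

lemma irreducible_involution_tuple_iff:
  assumes A: "(A1, A2, A3, A4) \<in> involution_tuples"
  defines "x \<equiv> trace (A1 ** A2)" and "y \<equiv> trace (A2 ** A3)" and "z \<equiv> trace (A1 ** A3)"
  shows "irreducible_tuple (A1, A2, A3, A4) \<and> \<not> central_GL A4 \<longleftrightarrow>
    \<not> (x^2 = 4 \<and> y^2 = 4 \<and> z^2 = 4) \<and> \<not> (x = 0 \<and> y = 0 \<and> z = 0)"
proof
  assume "irreducible_tuple (A1, A2, A3, A4) \<and> \<not> central_GL A4"
  then show "\<not> (x^2 = 4 \<and> y^2 = 4 \<and> z^2 = 4) \<and> \<not> (x = 0 \<and> y = 0 \<and> z = 0)"
    using rank_one_gram_involutions_reducible[OF A] involution_params_all_squares_4[OF A]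
      anticommuting_involutions_product_central[OF A]
    unfolding x_def y_def z_def by blast
next
  assume nz: "\<not> (x^2 = 4 \<and> y^2 = 4 \<and> z^2 = 4) \<and> \<not> (x = 0 \<and> y = 0 \<and> z = 0)"
  have inv: "A1 ** A2 ** A3 ** A4 = mat 1" "trace A1 = 0" "trace A2 = 0" "trace A3 = 0"
    "det A1 = -1" "det A2 = -1" "det A3 = -1"
    using A by (simp_all add: involution_tuples_iff)
  have pair: "(trace (X ** Y))^2 = 4"
    if v: "v \<noteq> 0" "area v (X *v v) = 0" "area v (Y *v v) = 0"
      and XY: "trace X = 0" "det X = -1" "trace Y = 0" "det Y = -1" for X Y v
  proof -
    obtain c d where "c^2 - trace X * c + det X = 0" "d^2 - trace Y * d + det Y = 0"
      "(c * d)^2 - trace (X ** Y) * (c * d) + det X * det Y = 0"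
      using common_eigenvector_trace[OF v] .
    then have "c^2 = 1" "d^2 = 1" and e: "(c * d)^2 - trace (X ** Y) * (c * d) + 1 = 0"
      by (simp_all add: XY)
    then have cd: "(c * d)^2 = 1"
      by (simp add: power_mult_distrib)
    have "trace (X ** Y) * (c * d) = 2"
      using e unfolding cd by simp
    then have "(trace (X ** Y))^2 * (c * d)^2 = 2^2"
      by (simp only: flip: power_mult_distrib)
    then show ?thesis
      unfolding cd by simp
  qed
  have "irreducible_tuple (A1, A2, A3, A4)"
    unfolding irreducible_iff_no_common_eigenvector[OF inv(1)]
  proof
    assume "\<exists>v. v \<noteq> 0 \<and> (\<forall>M\<in>{A1, A2, A3}. area v (M *v v) = 0)"
    then obtain v where v: "v \<noteq> 0" "area v (A1 *v v) = 0" "area v (A2 *v v) = 0" "area v (A3 *v v) = 0"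
      by blast
    have "x^2 = 4" "y^2 = 4" "z^2 = 4"
      unfolding x_def y_def z_def using pair v inv by simp_all
    with nz show False
      by simp
  qed
  moreover have "\<not> central_GL A4"
  proof
    assume "central_GL A4"
    then obtain d where d: "A4 = mat d"
      unfolding central_GL_iff by blast
    have scaled: "trace (M ** mat d) = d * trace M" "trace (mat d ** M) = d * trace M" for M :: "complex^2^2"
      by (simp_all add: mat2_simps algebra_simps)
    have cyc: "(A1 ** A2) ** (A3 ** mat d) = mat 1"
      using inv(1) by (simp add: d matrix_mul_assoc)
    from trace_inverse_pair[OF this] have "x = 0"
      by (simp add: x_def scaled inv)
    have "A1 ** (A2 ** A3 ** mat d) = mat 1"
      using inv(1) by (simp add: d matrix_mul_assoc)
    then have "(A2 ** A3) ** (mat d ** A1) = mat 1"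
      by (subst (asm) matrix_left_right_inverse) (simp add: matrix_mul_assoc)
    from trace_inverse_pair[OF this] have "y = 0"
      by (simp add: y_def scaled inv)
    from cyc have "A3 ** mat d ** (A1 ** A2) = mat 1"
      by (subst (asm) matrix_left_right_inverse)
    moreover have "A3 ** mat d ** (A1 ** A2) = (A3 ** A1) ** (mat d ** A2)"
    proof -
      have "mat d ** A1 = A1 ** mat d"
        by (simp add: mat2_simps)
      then show ?thesis
        by (metis matrix_mul_assoc)
    qed
    ultimately have "(A3 ** A1) ** (mat d ** A2) = mat 1"
      by simp
    from trace_inverse_pair[OF this] have "trace (A3 ** A1) = 0"
      by (simp add: scaled inv)
    then have "z = 0"
      unfolding z_def by (subst trace_mul_sym)
    with \<open>x = 0\<close> \<open>y = 0\<close> nz show False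
      by simp
  qed
  ultimately show "irreducible_tuple (A1, A2, A3, A4) \<and> \<not> central_GL A4" ..
qed

text \<open>
  On a common eigenvector the matrices act trivially, so the products have trace \<open>2\<close>. Conversely, if
  all these traces are \<open>2\<close>, the nilpotent matrices \<open>B\<^sub>i - 1\<close> are pairwise orthogonal for the trace form,
  and the kernel of a nonzero one is an eigenline of all of them.
\<close>

lemma irreducible_unipotent_tuple_iff:
  assumes B: "(B1, B2, B3, B4) \<in> unipotent_tuples"
  shows "irreducible_tuple (B1, B2, B3, B4) \<longleftrightarrow>
    \<not> (trace (B1 ** B2) = 2 \<and> trace (B2 ** B3) = 2 \<and> trace (B1 ** B3) = 2)"
proof -
  have uni: "B1 ** B2 ** B3 ** B4 = mat 1" "trace B1 = 2" "trace B2 = 2" "trace B3 = 2"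
    "det B1 = 1" "det B2 = 1" "det B3 = 1"
    using B by (simp_all add: unipotent_tuples_iff)
  have pair: "trace (X ** Y) = 2"
    if v: "v \<noteq> 0" "area v (X *v v) = 0" "area v (Y *v v) = 0"
      and XY: "trace X = 2" "det X = 1" "trace Y = 2" "det Y = 1" for X Y v
  proof -
    obtain c d where cd: "c^2 - trace X * c + det X = 0" "d^2 - trace Y * d + det Y = 0"
      "(c * d)^2 - trace (X ** Y) * (c * d) + det X * det Y = 0"
      using common_eigenvector_trace[OF v] .
    then have "(c - 1)^2 = 0" "(d - 1)^2 = 0"
      by (simp_all add: XY power2_eq_square algebra_simps)
    then have "c = 1" "d = 1"
      by simp_all
    with cd(3) show ?thesis
      by (simp add: XY)
  qed
  have "\<exists>v. v \<noteq> 0 \<and> (\<forall>M\<in>{B1, B2, B3}. area v (M *v v) = 0)"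
    if two: "trace (B1 ** B2) = 2" "trace (B2 ** B3) = 2" "trace (B1 ** B3) = 2"
  proof (cases "\<exists>X\<in>{B1, B2, B3}. X \<noteq> mat 1")
    case True
    then obtain X where X: "X \<in> {B1, B2, B3}" "X \<noteq> mat 1"
      by blast
    have "trace X = 2" "det X = 1"
      using X uni by auto
    then have nil: "trace (X - mat 1) = 0" "det (X - mat 1) = 0" "X - mat 1 \<noteq> 0"
      using X(2) trace_diff_scaled(1,3)[of X 1 "mat 1"] by (simp_all add: trace_I)
    have "trace (X ** M) = 2" if "M \<in> {B1, B2, B3}" for M
    proof -
      have "trace (B2 ** B1) = 2" "trace (B3 ** B2) = 2" "trace (B3 ** B1) = 2"
        using two by (metis trace_mul_sym)+
      moreover have "trace (B1 ** B1) = 2" "trace (B2 ** B2) = 2" "trace (B3 ** B3) = 2"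
        by (simp_all add: trace_square_2 uni)
      ultimately show ?thesis
        using X(1) that two by auto
    qed
    then have "trace ((X - mat 1) ** M) = 0" if "M \<in> {B1, B2, B3}" for M
      using that uni trace_diff_scaled(2)[of X 1 "mat 1" M] by auto
    then show ?thesis
      using nilpotent_kernel_is_eigenline[OF nil] by metis
  next
    case False
    then have "\<forall>M\<in>{B1, B2, B3}. area (axis 1 1) (M *v axis 1 1) = 0"
      by (auto simp: area_def)
    moreover have "axis 1 1 \<noteq> (0 :: complex^2)"
      by (simp add: axis_eq_0_iff)
    ultimately show ?thesis
      by blast
  qed
  moreover have "trace (B1 ** B2) = 2 \<and> trace (B2 ** B3) = 2 \<and> trace (B1 ** B3) = 2"
    if "v \<noteq> 0" "\<forall>M\<in>{B1, B2, B3}. area v (M *v v) = 0" for v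
    using that pair[of v B1 B2] pair[of v B2 B3] pair[of v B1 B3] uni by simp
  ultimately show ?thesis
    unfolding irreducible_iff_no_common_eigenvector[OF uni(1)] by blast
qed

section \<open>The transformation on classes of Fricke parameters\<close>

lemma bij_betw_induced_on_quotient:
  assumes r: "equiv X r" and f: "f respects r"
    and inj: "\<And>p q. p \<in> X \<Longrightarrow> q \<in> X \<Longrightarrow> f p = f q \<Longrightarrow> (p, q) \<in> r"
  shows "bij_betw (\<lambda>c. the_elem (f ` c)) (X // r) (f ` X)"
proof -
  have val: "the_elem (f ` (r `` {p})) = f p" if "p \<in> X" for p
  proof -
    have "f ` (r `` {p}) = {f p}"
      using that equiv_class_self[OF r] congruentD[OF f] by fastforce
    then show ?thesis
      by simp
  qed
  show ?thesis
    unfolding bij_betw_def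
  proof
    show "inj_on (\<lambda>c. the_elem (f ` c)) (X // r)"
    proof (rule inj_onI)
      fix c d assume c: "c \<in> X // r" and d: "d \<in> X // r" and e: "the_elem (f ` c) = the_elem (f ` d)"
      obtain p q where "c = r `` {p}" "p \<in> X" "d = r `` {q}" "q \<in> X"
        using c d by (meson quotientE)
      then show "c = d"
        using e val inj equiv_class_eq[OF r] by metis
    qed
    show "(\<lambda>c. the_elem (f ` c)) ` (X // r) = f ` X"
    proof (intro Set.equalityI subsetI)
      fix y assume "y \<in> (\<lambda>c. the_elem (f ` c)) ` (X // r)"
      then show "y \<in> f ` X"
        using val by (auto elim!: quotientE)
    next
      fix y assume "y \<in> f ` X"
      then obtain p where p: "p \<in> X" "y = the_elem (f ` (r `` {p}))"
        using val by auto
      then have "r `` {p} \<in> X // r"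
        by (intro quotientI)
      then show "y \<in> (\<lambda>c. the_elem (f ` c)) ` (X // r)"
        by (rule image_eqI[rotated]) (rule p(2))
    qed
  qed
qed

lemma signs_square: "(s1, s2, s3, s4) \<in> signs \<Longrightarrow> s1^2 = 1 \<and> s2^2 = 1 \<and> s3^2 = 1 \<and> s4^2 = 1"
  by (auto simp: signs_def)

lemma scaled_mult: "(mat s ** M) ** (mat t ** N) = mat (s * t) ** (M ** N)"
  for M N :: "complex^2^2"
  by (simp add: mat2_simps algebra_simps)

lemma scaled_trace_det:
  fixes M :: "complex^2^2"
  shows "trace (mat s ** M) = s * trace M" "det (mat s ** M) = s^2 * det M"
  by (simp_all add: mat2_simps algebra_simps power2_eq_square)

lemma fricke_sign_twist:
  fixes A1 A2 A3 A4 :: "complex^2^2"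
  shows "fricke (sign_twist (s1, s2, s3, s4) (A1, A2, A3, A4)) =
    (s1 * trace A1, s2 * trace A2, s3 * trace A3, s4 * trace A4,
     s1 * s2 * trace (A1 ** A2), s2 * s3 * trace (A2 ** A3), s1 * s3 * trace (A1 ** A3))"
  by (simp add: scaled_mult scaled_trace_det)

lemma involution_tuples_sign_twist:
  assumes A: "(A1, A2, A3, A4) \<in> involution_tuples" and s: "(s1, s2, s3, s4) \<in> signs"
  shows "sign_twist (s1, s2, s3, s4) (A1, A2, A3, A4) \<in> involution_tuples"
proof -
  have sq: "s1^2 = 1" "s2^2 = 1" "s3^2 = 1" "s4^2 = 1" and s1: "s1 * s2 * s3 * s4 = 1"
    using signs_square[OF s] s by (auto simp: signs_def)
  have inv: "A1 ** A2 ** A3 ** A4 = mat 1" "\<forall>M\<in>{A1, A2, A3}. trace M = 0 \<and> det M = -1"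
    and roots: "\<forall>c. c^2 - trace A4 * c - 1 = 0 \<longrightarrow> root_of_unity c"
    using A by (simp_all add: involution_tuples_iff)
  have "(mat s1 ** A1) ** (mat s2 ** A2) ** (mat s3 ** A3) ** (mat s4 ** A4) = mat 1"
    by (simp only: scaled_mult s1 inv matrix_mul_lid)
  moreover have "root_of_unity c" if "c^2 - s4 * trace A4 * c - 1 = 0" for c
  proof -
    have "(s4 * c)^2 - trace A4 * (s4 * c) - 1 = 0"
      using that sq(4) by (simp add: power_mult_distrib mult_ac)
    then have "root_of_unity (s4 * c)"
      using roots by blast
    moreover have "s4 = 1 \<or> s4 = - 1"
      using sq(4) by (simp add: power2_eq_1_iff)
    ultimately show ?thesis
      by (auto simp: root_of_unity_minus_iff)
  qed
  ultimately show ?thesis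
    using inv(2) by (simp add: involution_tuples_iff scaled_trace_det sq)
qed

lemma irreducible_involution_tuples_iff:
  "A \<in> irreducible_involution_tuples \<longleftrightarrow> A \<in> involution_tuples \<and>
    (case fricke A of (_, _, _, _, x, y, z) \<Rightarrow>
      \<not> (x^2 = 4 \<and> y^2 = 4 \<and> z^2 = 4) \<and> \<not> (x = 0 \<and> y = 0 \<and> z = 0))"
proof -
  obtain A1 A2 A3 A4 where A: "A = (A1, A2, A3, A4)"
    by (rule prod_cases4)
  have "A \<in> irreducible_involution_tuples \<longleftrightarrow>
      A \<in> involution_tuples \<and> irreducible_tuple A \<and> \<not> central_GL A4"
    by (simp add: A irreducible_involution_tuples_def del: irreducible_tuple.simps)
  also have "\<dots> \<longleftrightarrow> A \<in> involution_tuples \<and>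
      (case fricke A of (_, _, _, _, x, y, z) \<Rightarrow>
        \<not> (x^2 = 4 \<and> y^2 = 4 \<and> z^2 = 4) \<and> \<not> (x = 0 \<and> y = 0 \<and> z = 0))"
    unfolding A using irreducible_involution_tuple_iff[of A1 A2 A3 A4]
    by (cases "(A1, A2, A3, A4) \<in> involution_tuples") (simp_all only: fricke.simps prod.case simp_thms)
  finally show ?thesis .
qed

lemma irreducible_involution_tuples_sign_twist:
  assumes A: "A \<in> irreducible_involution_tuples" and s: "s \<in> signs"
  shows "sign_twist s A \<in> irreducible_involution_tuples"
proof -
  obtain A1 A2 A3 A4 where eA: "A = (A1, A2, A3, A4)"
    by (rule prod_cases4)
  obtain s1 s2 s3 s4 where es: "s = (s1, s2, s3, s4)"
    by (rule prod_cases4)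
  note e = eA es
  have "s1 \<noteq> 0" "s2 \<noteq> 0" "s3 \<noteq> 0" and sq: "s1^2 = 1" "s2^2 = 1" "s3^2 = 1"
    using signs_square[of s1 s2 s3 s4] s e by auto
  moreover have "fricke (sign_twist s A) =
    (s1 * trace A1, s2 * trace A2, s3 * trace A3, s4 * trace A4,
     s1 * s2 * trace (A1 ** A2), s2 * s3 * trace (A2 ** A3), s1 * s3 * trace (A1 ** A3))"
    unfolding e by (rule fricke_sign_twist)
  moreover have "sign_twist s A \<in> involution_tuples"
    using A s involution_tuples_sign_twist unfolding e irreducible_involution_tuples_iff by blast
  ultimately show ?thesis
    using A unfolding irreducible_involution_tuples_iff
    by (simp add: e power_mult_distrib)
qed

text \<open>
  Equal squares give signs for \<open>x, y, z\<close>, and \<open>x y z = x' y' z'\<close> makes the product of these signs \<open>1\<close>,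
  unless one of the coordinates vanishes, in which case its sign is free. Signs with product \<open>1\<close> are of
  the form \<open>s1 s2, s2 s3, s1 s3\<close>, and a common sign of \<open>s1, s2, s3\<close> is still available to adjust the
  sign of \<open>a\<close>.
\<close>

lemma signs_if_squares_eq:
  fixes x y z x' y' z' a a' :: complex
  assumes "x^2 = x'^2" "y^2 = y'^2" "z^2 = z'^2" "a^2 = a'^2" and xyz: "x * y * z = x' * y' * z'"
  obtains s1 s2 s3 s4 where "(s1, s2, s3, s4) \<in> signs"
    "a' = s4 * a" "x' = s1 * s2 * x" "y' = s2 * s3 * y" "z' = s1 * s3 * z"
proof -
  have sign: "\<exists>e\<in>{1, -1}. v = e * u" if "u^2 = v^2" for u v :: complex
    using that by (auto simp: power2_eq_iff)
  obtain e1 where e1: "e1 \<in> {1, -1}" "x' = e1 * x"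
    using sign[OF assms(1)] by blast
  obtain e2 where e2: "e2 \<in> {1, -1}" "y' = e2 * y"
    using sign[OF assms(2)] by blast
  obtain e3 where e3: "e3 \<in> {1, -1}" "z' = e3 * z"
    using sign[OF assms(3)] by blast
  obtain d where d: "d \<in> {1, -1}" "a' = d * a"
    using sign[OF assms(4)] by blast
  note e = e1 e2 e3
  have "\<exists>e1\<in>{1, -1}. \<exists>e2\<in>{1, -1}. \<exists>e3\<in>{1, -1}.
    x' = e1 * x \<and> y' = e2 * y \<and> z' = e3 * z \<and> e1 * e2 * e3 = 1"
  proof (cases "e1 * e2 * e3 = 1")
    case True
    then show ?thesis
      using e by blast
  next
    case False
    then have "e1 * e2 * e3 = - 1"
      using e by auto
    moreover have "x' * y' * z' = (e1 * e2 * e3) * (x * y * z)"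
      unfolding e by (simp only: mult_ac)
    ultimately have "x * y * z = - (x * y * z)"
      using xyz by simp
    then have "2 * (x * y * z) = 0"
      by algebra
    then consider "x = 0" | "y = 0" | "z = 0"
      by auto
    then show ?thesis
    proof cases
      case 1
      then have "x' = (- e1) * x" "(- e1) \<in> {1, -1}" "(- e1) * e2 * e3 = 1"
        using e \<open>e1 * e2 * e3 = - 1\<close> by auto
      then show ?thesis
        using e by blast
    next
      case 2
      then have "y' = (- e2) * y" "(- e2) \<in> {1, -1}" "e1 * (- e2) * e3 = 1"
        using e \<open>e1 * e2 * e3 = - 1\<close> by auto
      then show ?thesis
        using e by blast
    next
      case 3
      then have "z' = (- e3) * z" "(- e3) \<in> {1, -1}" "e1 * e2 * (- e3) = 1"
        using e \<open>e1 * e2 * e3 = - 1\<close> by auto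
      then show ?thesis
        using e by blast
    qed
  qed
  then obtain e1 e2 e3 where e: "e1 \<in> {1, -1}" "e2 \<in> {1, -1}" "e3 \<in> {1, -1}"
    "x' = e1 * x" "y' = e2 * y" "z' = e3 * z" "e1 * e2 * e3 = 1"
    by blast
  define t where "t = d * e1 * e2"
  have "(t * e1, t, t * e2, d) \<in> signs"
    using e(1-3) d(1) by (auto simp: signs_def t_def)
  moreover have t: "t * t = 1" and e3: "e3 = e1 * e2"
    using e(1-3,7) d(1) by (auto simp: t_def)
  have "x' = (t * e1) * t * x" "y' = t * (t * e2) * y" "z' = (t * e1) * (t * e2) * z"
    using t unfolding e(4-6) e3 by algebra+
  ultimately show thesis
    using that d(2) by blast
qed

text \<open>
  The sign relation is the kernel relation of \<open>phi_params\<close>: the transformation depends on the squares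
  of the coordinates, and points with equal squares are related by a sign twist, since the relation
  between the parameters recovers \<open>x y z\<close> from the squares.
\<close>

lemma bij_on_classes_phi_params:
  assumes sub: "S \<subseteq> involution_tuples" and twist: "\<And>A s. A \<in> S \<Longrightarrow> s \<in> signs \<Longrightarrow> sign_twist s A \<in> S"
  shows "bij_on_classes phi_params S (phi_params ` fricke ` S)"
proof -
  have twisted: "\<exists>s\<in>signs. q = fricke (sign_twist s A)"
    if p: "p = (0, 0, 0, a, x, y, z)" "p = fricke A" and q: "q = (0, 0, 0, a', x', y', z')"
      and s: "(s1, s2, s3, s4) \<in> signs" "a' = s4 * a" "x' = s1 * s2 * x" "y' = s2 * s3 * y" "z' = s1 * s3 * z"
    for A :: "2 tuple4" and p q a x y z a' x' y' z' s1 s2 s3 s4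
  proof -
    obtain A1 A2 A3 A4 where "A = (A1, A2, A3, A4)"
      by (rule prod_cases4)
    then have "fricke (sign_twist (s1, s2, s3, s4) A) = q"
      using p q s(2-5) by (simp add: scaled_mult scaled_trace_det)
    with s(1) show ?thesis
      by blast
  qed
  have params: "\<exists>a x y z. fricke A = (0, 0, 0, a, x, y, z) \<and> a^2 = x^2 + y^2 + z^2 - x * y * z - 4"
    if "A \<in> S" for A
  proof -
    obtain A1 A2 A3 A4 where A: "A = (A1, A2, A3, A4)"
      by (rule prod_cases4)
    with that sub have "(A1, A2, A3, A4) \<in> involution_tuples"
      by blast
    then show ?thesis
      using involution_tuple_relation unfolding A by (simp add: involution_tuples_iff)
  qed
  have rel_iff: "(p, q) \<in> sign_rel S \<longleftrightarrow> p \<in> fricke ` S \<and> q \<in> fricke ` S \<and> phi_params p = phi_params q" for p q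
  proof
    assume "(p, q) \<in> sign_rel S"
    then obtain A s where A: "p = fricke A" "q = fricke (sign_twist s A)" "A \<in> S" "s \<in> signs"
      unfolding sign_rel_def by blast
    obtain A1 A2 A3 A4 where eA: "A = (A1, A2, A3, A4)"
      by (rule prod_cases4)
    obtain s1 s2 s3 s4 where es: "s = (s1, s2, s3, s4)"
      by (rule prod_cases4)
    note e = eA es
    have "phi_params p = phi_params q"
      unfolding A(1,2) e fricke_sign_twist using signs_square[of s1 s2 s3 s4] A(4) e
      by (simp add: power_mult_distrib)
    with A twist show "p \<in> fricke ` S \<and> q \<in> fricke ` S \<and> phi_params p = phi_params q"
      by blast
  next
    assume pq: "p \<in> fricke ` S \<and> q \<in> fricke ` S \<and> phi_params p = phi_params q"
    then obtain A where A: "A \<in> S" "p = fricke A"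
      by blast
    obtain a x y z where p: "p = (0, 0, 0, a, x, y, z)" "a^2 = x^2 + y^2 + z^2 - x * y * z - 4"
      using params[OF A(1)] A(2) by metis
    obtain a' x' y' z' where q: "q = (0, 0, 0, a', x', y', z')"
      "a'^2 = x'^2 + y'^2 + z'^2 - x' * y' * z' - 4"
      using params pq by blast
    have sq: "x^2 = x'^2" "y^2 = y'^2" "z^2 = z'^2" "a^2 = a'^2"
      using pq p(1) q(1) by simp_all
    moreover have "x * y * z = x' * y' * z'"
      using p(2) q(2) unfolding sq by simp
    ultimately obtain s1 s2 s3 s4 where "(s1, s2, s3, s4) \<in> signs"
      "a' = s4 * a" "x' = s1 * s2 * x" "y' = s2 * s3 * y" "z' = s1 * s3 * z"
      by (rule signs_if_squares_eq)
    then obtain s where "s \<in> signs" "q = fricke (sign_twist s A)"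
      using twisted[OF p(1) A(2) q(1)] by blast
    with A show "(p, q) \<in> sign_rel S"
      unfolding sign_rel_def by blast
  qed
  have equiv: "equiv (fricke ` S) (sign_rel S)"
    by (rule equivI) (auto simp: rel_iff refl_on_def intro!: symI transI)
  moreover have resp: "phi_params respects (sign_rel S)"
    by (auto simp: rel_iff intro!: congruentI)
  moreover have "bij_betw (\<lambda>c. the_elem (phi_params ` c)) ((fricke ` S) // sign_rel S) (phi_params ` fricke ` S)"
    using equiv resp by (rule bij_betw_induced_on_quotient) (simp add: rel_iff)
  ultimately show ?thesis
    unfolding bij_on_classes_def by blast
qed

text \<open>
  The two exceptional sets in the parameter criterion for irreducible tuples of involutions correspond
  to reducible unipotent tuples (\<open>x = y = z = 0\<close>) and to the removed point (\<open>x\<^sup>2 = y\<^sup>2 = z\<^sup>2 = 4\<close>,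
  where \<open>a = 0\<close>).
\<close>

lemma phi_params_image_irreducible:
  "phi_params ` fricke ` irreducible_involution_tuples =
    fricke ` {B \<in> unipotent_tuples. irreducible_tuple B} - {(2, 2, 2, -2, -2, -2, -2)}"
proof (intro Set.equalityI subsetI)
  fix p assume "p \<in> phi_params ` fricke ` irreducible_involution_tuples"
  then obtain A1 A2 A3 A4 where A: "(A1, A2, A3, A4) \<in> irreducible_involution_tuples"
    and p: "p = phi_params (fricke (A1, A2, A3, A4))"
    by auto
  define x y z where "x = trace (A1 ** A2)" and "y = trace (A2 ** A3)" and "z = trace (A1 ** A3)"
  have inv: "(A1, A2, A3, A4) \<in> involution_tuples"
    and nz: "\<not> (x^2 = 4 \<and> y^2 = 4 \<and> z^2 = 4)" "\<not> (x = 0 \<and> y = 0 \<and> z = 0)"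
    using A unfolding irreducible_involution_tuples_iff by (simp_all add: x_def y_def z_def)
  have p': "p = (2, 2, 2, - ((trace A4)^2) - 2, - (x^2 - 2), - (y^2 - 2), - (z^2 - 2))"
    by (simp add: p x_def y_def z_def)
  have "p \<in> fricke ` unipotent_tuples"
    using inv p unfolding phi_params_image[symmetric] by blast
  then obtain B1 B2 B3 B4 where B: "(B1, B2, B3, B4) \<in> unipotent_tuples" "p = fricke (B1, B2, B3, B4)"
    by auto
  have "\<not> (trace (B1 ** B2) = 2 \<and> trace (B2 ** B3) = 2 \<and> trace (B1 ** B3) = 2)"
    using B(2) nz(2) by (auto simp: p')
  then have "irreducible_tuple (B1, B2, B3, B4)"
    using irreducible_unipotent_tuple_iff[OF B(1)] by blast
  moreover have "p \<noteq> (2, 2, 2, -2, -2, -2, -2)"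
    using nz(1) by (auto simp: p')
  ultimately show "p \<in> fricke ` {B \<in> unipotent_tuples. irreducible_tuple B} - {(2, 2, 2, -2, -2, -2, -2)}"
    using B by blast
next
  fix p assume p: "p \<in> fricke ` {B \<in> unipotent_tuples. irreducible_tuple B} - {(2, 2, 2, -2, -2, -2, -2)}"
  then obtain B1 B2 B3 B4 where B: "(B1, B2, B3, B4) \<in> unipotent_tuples" "irreducible_tuple (B1, B2, B3, B4)"
    "p = fricke (B1, B2, B3, B4)"
    by auto
  have "p \<in> phi_params ` fricke ` involution_tuples"
    unfolding phi_params_image using B by blast
  then obtain A1 A2 A3 A4 where A: "(A1, A2, A3, A4) \<in> involution_tuples"
    and pA: "p = phi_params (fricke (A1, A2, A3, A4))"
    by auto
  define x y z where "x = trace (A1 ** A2)" and "y = trace (A2 ** A3)" and "z = trace (A1 ** A3)"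
  have p': "p = (2, 2, 2, - ((trace A4)^2) - 2, - (x^2 - 2), - (y^2 - 2), - (z^2 - 2))"
    by (simp add: pA x_def y_def z_def)
  have "\<not> (x = 0 \<and> y = 0 \<and> z = 0)"
  proof
    assume "x = 0 \<and> y = 0 \<and> z = 0"
    then have "trace (B1 ** B2) = 2" "trace (B2 ** B3) = 2" "trace (B1 ** B3) = 2"
      using B(3) p' by simp_all
    then show False
      using irreducible_unipotent_tuple_iff[OF B(1)] B(2) by blast
  qed
  moreover have "\<not> (x^2 = 4 \<and> y^2 = 4 \<and> z^2 = 4)"
  proof
    assume sq: "x^2 = 4 \<and> y^2 = 4 \<and> z^2 = 4"
    then have "trace A4 = 0"
      using involution_params_all_squares_4(1)[OF A] by (simp add: x_def y_def z_def)
    with sq p p' show False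
      by simp
  qed
  ultimately have "(A1, A2, A3, A4) \<in> irreducible_involution_tuples"
    using A unfolding irreducible_involution_tuples_iff by (simp add: x_def y_def z_def)
  with pA show "p \<in> phi_params ` fricke ` irreducible_involution_tuples"
    by blast
qed

lemma is_phi_existence_and_params:
  assumes A: "A \<in> irreducible_involution_tuples"
  shows "\<exists>B. is_phi A B"
    and "is_phi A B \<Longrightarrow> B \<in> unipotent_tuples \<and> fricke B = phi_params (fricke A)"
proof -
  obtain A1 A2 A3 A4 where e: "A = (A1, A2, A3, A4)"
    by (rule prod_cases4)
  define x y z where "x = trace (A1 ** A2)" and "y = trace (A2 ** A3)" and "z = trace (A1 ** A3)"
  have inv: "(A1, A2, A3, A4) \<in> involution_tuples" and nz: "\<not> (x = 0 \<and> y = 0 \<and> z = 0)"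
    using A unfolding irreducible_involution_tuples_iff e by (simp_all add: x_def y_def z_def)
  have tr: "trace A1 = 0" "det A1 = -1" "trace A2 = 0" "det A2 = -1" "trace A3 = 0" "det A3 = -1"
    using inv by (simp_all add: involution_tuples_iff)
  note phi = is_phi_iff[OF tr x_def y_def z_def nz]
  obtain u1 u2 u3 where "area u1 u2 = x" "area u2 u3 = y" "area u1 u3 = z"
    by (rule transvections_with_areas_exist)
  then show "\<exists>B. is_phi A B"
    unfolding e using phi by blast
  assume "is_phi A B"
  moreover obtain B1 B2 B3 B4 where B: "B = (B1, B2, B3, B4)"
    by (rule prod_cases4)
  ultimately obtain u1 u2 u3 where u: "area u1 u2 = x" "area u2 u3 = y" "area u1 u3 = z"
    and t: "B1 = transvection u1" "B2 = transvection u2" "B3 = transvection u3"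
    and B4: "B4 = matrix_inv (B1 ** B2 ** B3)"
    unfolding e using phi by blast
  have b: "2 - x^2 - y^2 - z^2 + x * y * z = - ((trace A4)^2) - 2"
    using involution_tuple_relation[OF inv] by (simp add: x_def y_def z_def)
  have roots: "\<forall>c. c^2 - (2 - x^2 - y^2 - z^2 + x * y * z) * c + 1 = 0 \<longrightarrow> root_of_unity c"
    unfolding b roots_of_unity_transfer using inv by (simp add: involution_tuples_iff)
  have "phi_params (fricke A) = (2, 2, 2, 2 - x^2 - y^2 - z^2 + x * y * z, 2 - x^2, 2 - y^2, 2 - z^2)"
    unfolding b by (simp add: e x_def y_def z_def)
  then show "B \<in> unipotent_tuples \<and> fricke B = phi_params (fricke A)"
    using transvection_tuple[OF u roots] unfolding B B4 t by (simp only: simp_thms)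
qed

theorem theorem4p11:
  shows "(\<forall>A\<in>irreducible_involution_tuples.
            (\<exists>B. is_phi A B) \<and>
            (\<forall>B. is_phi A B \<longrightarrow> B \<in> unipotent_tuples \<and> fricke B = phi_params (fricke A)))
       \<and> bij_on_classes phi_params involution_tuples (fricke ` unipotent_tuples)
       \<and> bij_on_classes phi_params irreducible_involution_tuples
           (fricke ` {B \<in> unipotent_tuples. irreducible_tuple B} - {(2, 2, 2, -2, -2, -2, -2)})"
proof (intro conjI)
  show "\<forall>A\<in>irreducible_involution_tuples. (\<exists>B. is_phi A B) \<and>
      (\<forall>B. is_phi A B \<longrightarrow> B \<in> unipotent_tuples \<and> fricke B = phi_params (fricke A))"
    using is_phi_existence_and_params by blast
  have "sign_twist s A \<in> involution_tuples" if "A \<in> involution_tuples" "s \<in> signs" for A s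
    using that involution_tuples_sign_twist by (cases A rule: prod_cases4, cases s rule: prod_cases4) blast
  then show "bij_on_classes phi_params involution_tuples (fricke ` unipotent_tuples)"
    unfolding phi_params_image[symmetric] by (intro bij_on_classes_phi_params) auto
  show "bij_on_classes phi_params irreducible_involution_tuples
      (fricke ` {B \<in> unipotent_tuples. irreducible_tuple B} - {(2, 2, 2, -2, -2, -2, -2)})"
    unfolding phi_params_image_irreducible[symmetric]
    by (intro bij_on_classes_phi_params irreducible_involution_tuples_sign_twist)
      (auto simp: irreducible_involution_tuples_iff)
qed

end
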